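(* Let $\mathcal{H}$ be a complex Hilbert space and $T\in\mathcal{B}(\mathcal{H})$. Then $T$ has a left invertible quasi-isometric lifting $S$ on a Hilbert space $\mathcal{K}\supset\mathcal{H}$ with $S^*S\mathcal{H}\subset\mathcal{H}$ if and only if there exists an invertible operator $A\in\mathcal{B}(\mathcal{H})$ such that $$A\ge T^*T,\qquad A\ge T^*AT,\qquad \mathcal{R}\big[(A-T^*T)^{1/2}\big]=\mathcal{R}\big[(A-T^*AT)^{1/2}\big].$$ In this case, $S$ can be chosen to be also a minimal lifting for $T$ (that is, there is such an $S$, left invertible, quasi-isometric, with $S^*S\mathcal{H}\subset\mathcal{H}$, which is a minimal lifting for $T$).
   Context: $\mathcal{B}(\mathcal{H})$ is the algebra of bounded operators on the complex Hilbert space $\mathcal{H}$; $\mathcal{R}(X)$ is the range of $X$; $B\ge C$ means $B-C$ is positive (i.e. $((B-C)h,h)\ge 0$ for all $h$). When $\mathcal{K}\supset\mathcal{H}$ is a Hilbert space containing $\mathcal{H}$ as a closed subspace and $P_{\mathcal{K},\mathcal{H}}:\mathcal{K}\to\mathcal{H}$ is the orthogonal projection, an operator $S\in\mathcal{B}(\mathcal{K})$ is a lifting for $T\in\mathcal{B}(\mathcal{H})$ if $P_{\mathcal{K},\mathcal{H}}S=TP_{\mathcal{K},\mathcal{H}}$. The lifting is minimal if $\mathcal{K}$ is the closed linear span of $\bigcup_{n\ge 0}S^n\mathcal{H}$. An operator $S$ is a quasi-isometry (quasi-isometric) if $S^{*2}S^2=S^*S$. $S$ is left invertible if it is injective with closed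 range, equivalently $S^*S$ is invertible. *)

theory Defs
  imports "HOL-Analysis.Analysis"
begin

section \<open>Complex Hilbert spaces\<close>

text \<open>
  The inner product \<open>cinner\<close> is linear in its first argument.  The last axiom ties the library's
  real inner product, and hence norm and topology, to the complex one, so that
  \<open>norm x = sqrt (Re (cinner x x))\<close>.
\<close>

class complex_inner = real_inner +
  fixes scaleC :: "complex \<Rightarrow> 'a \<Rightarrow> 'a"  (infixr "*\<^sub>C" 75)
    and cinner :: "'a \<Rightarrow> 'a \<Rightarrow> complex"
  assumes scaleC_add_right: "c *\<^sub>C (x + y) = c *\<^sub>C x + c *\<^sub>C y"
    and scaleC_add_left: "(c + d) *\<^sub>C x = c *\<^sub>C x + d *\<^sub>C x"
    and scaleC_scaleC: "c *\<^sub>C (d *\<^sub>C x) = (c * d) *\<^sub>C x"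
    and scaleR_scaleC: "r *\<^sub>R x = complex_of_real r *\<^sub>C x"
    and cinner_commute: "cinner x y = cnj (cinner y x)"
    and cinner_add_left: "cinner (x + y) z = cinner x z + cinner y z"
    and cinner_scaleC_left: "cinner (c *\<^sub>C x) y = c * cinner x y"
    and inner_eq_Re_cinner: "inner x y = Re (cinner x y)"

class chilbert_space = complex_inner + complete_space

instantiation complex :: chilbert_space
begin

definition scaleC_complex :: "complex \<Rightarrow> complex \<Rightarrow> complex" where "scaleC_complex c x = c * x"
definition cinner_complex :: "complex \<Rightarrow> complex \<Rightarrow> complex" where "cinner_complex x y = x * cnj y"

instance
  by standard
    (auto simp: scaleC_complex_def cinner_complex_def algebra_simps scaleR_conv_of_real
      inner_complex_def)

end


section \<open>Subspaces and operators\<close>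

text \<open>
  A Hilbert space \<open>\<K>\<close> is represented by a closed subspace \<open>K\<close> of a type of class
  \<^class>\<open>chilbert_space\<close>, and an operator on \<open>\<K>\<close> by a function of which only the values on \<open>K\<close>
  matter.  A whole type is the case \<open>K = UNIV\<close>.
\<close>

definition csubspace :: "'a::complex_inner set \<Rightarrow> bool" where
  "csubspace V \<longleftrightarrow> 0 \<in> V \<and> (\<forall>x\<in>V. \<forall>y\<in>V. x + y \<in> V) \<and> (\<forall>c. \<forall>x\<in>V. c *\<^sub>C x \<in> V)"

definition cspan :: "'a::complex_inner set \<Rightarrow> 'a set" where
  "cspan X = csubspace hull X"

definition bounded_op_on :: "'a::complex_inner set \<Rightarrow> ('a \<Rightarrow> 'a) \<Rightarrow> bool" where
  "bounded_op_on K S \<longleftrightarrow>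
     S ` K \<subseteq> K \<and>
     (\<forall>x\<in>K. \<forall>y\<in>K. S (x + y) = S x + S y) \<and>
     (\<forall>c. \<forall>x\<in>K. S (c *\<^sub>C x) = c *\<^sub>C S x) \<and>
     (\<exists>B. \<forall>x\<in>K. norm (S x) \<le> B * norm x)"

definition adj_on :: "'a::complex_inner set \<Rightarrow> ('a \<Rightarrow> 'a) \<Rightarrow> 'a \<Rightarrow> 'a" where
  "adj_on K S y = (THE z. z \<in> K \<and> (\<forall>x\<in>K. cinner (S x) y = cinner x z))"

abbreviation bounded_op :: "('a::complex_inner \<Rightarrow> 'a) \<Rightarrow> bool" where
  "bounded_op \<equiv> bounded_op_on UNIV"

abbreviation adj :: "('a::complex_inner \<Rightarrow> 'a) \<Rightarrow> 'a \<Rightarrow> 'a" where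
  "adj \<equiv> adj_on UNIV"

definition invertible_op :: "('a::complex_inner \<Rightarrow> 'a) \<Rightarrow> bool" where
  "invertible_op A \<longleftrightarrow> bounded_op A \<and> (\<exists>B. bounded_op B \<and> A \<circ> B = id \<and> B \<circ> A = id)"

definition positive_op :: "('a::complex_inner \<Rightarrow> 'a) \<Rightarrow> bool" where
  "positive_op B \<longleftrightarrow> (\<forall>h. cinner (B h) h \<in> \<real>\<^sub>\<ge>\<^sub>0)"

definition op_ge :: "('a::complex_inner \<Rightarrow> 'a) \<Rightarrow> ('a \<Rightarrow> 'a) \<Rightarrow> bool"  (infix "\<ge>\<^sub>o\<^sub>p" 50) where
  "B \<ge>\<^sub>o\<^sub>p C \<longleftrightarrow> positive_op (\<lambda>h. B h - C h)"

definition op_sqrt :: "('a::complex_inner \<Rightarrow> 'a) \<Rightarrow> 'a \<Rightarrow> 'a" where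
  "op_sqrt B = (THE R. bounded_op R \<and> positive_op R \<and> R \<circ> R = B)"

definition quasi_isometry_on :: "'a::complex_inner set \<Rightarrow> ('a \<Rightarrow> 'a) \<Rightarrow> bool" where
  "quasi_isometry_on K S \<longleftrightarrow>
     (\<forall>x\<in>K. adj_on K S (adj_on K S (S (S x))) = adj_on K S (S x))"

definition left_invertible_on :: "'a::complex_inner set \<Rightarrow> ('a \<Rightarrow> 'a) \<Rightarrow> bool" where
  "left_invertible_on K S \<longleftrightarrow> inj_on S K \<and> closed (S ` K)"


section \<open>Extensions and liftings\<close>

text \<open>
  The inclusion \<open>\<H> \<subseteq> \<K>\<close> is given by a linear isometry \<open>J\<close> of the type representing \<open>\<H>\<close> into
  \<open>K\<close>; its range is closed because \<open>\<H>\<close> is complete.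
\<close>

definition hilbert_extension ::
    "'a::complex_inner set \<Rightarrow> ('h::complex_inner \<Rightarrow> 'a) \<Rightarrow> bool" where
  "hilbert_extension K J \<longleftrightarrow>
     csubspace K \<and> closed K \<and> range J \<subseteq> K \<and>
     (\<forall>x y. J (x + y) = J x + J y) \<and> (\<forall>c x. J (c *\<^sub>C x) = c *\<^sub>C J x) \<and>
     (\<forall>x y. cinner (J x) (J y) = cinner x y)"

definition proj_onto :: "('h::complex_inner \<Rightarrow> 'a::complex_inner) \<Rightarrow> 'a \<Rightarrow> 'h" where
  "proj_onto J k = (THE h. \<forall>g. cinner (k - J h) (J g) = 0)"

definition lifting ::
    "'a::complex_inner set \<Rightarrow> ('h::complex_inner \<Rightarrow> 'a) \<Rightarrow> ('a \<Rightarrow> 'a) \<Rightarrow> ('h \<Rightarrow> 'h) \<Rightarrow> bool" where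
  "lifting K J S T \<longleftrightarrow>
     hilbert_extension K J \<and> bounded_op_on K S \<and>
     (\<forall>k\<in>K. proj_onto J (S k) = T (proj_onto J k))"

definition minimal_lifting ::
    "'a::complex_inner set \<Rightarrow> ('h::complex_inner \<Rightarrow> 'a) \<Rightarrow> ('a \<Rightarrow> 'a) \<Rightarrow> ('h \<Rightarrow> 'h) \<Rightarrow> bool" where
  "minimal_lifting K J S T \<longleftrightarrow>
     lifting K J S T \<and> K = closure (cspan (\<Union>n. (S ^^ n) ` range J))"


section \<open>The space of square-summable sequences\<close>

text \<open>
  HOL cannot quantify over the type carrying \<open>\<K>\<close>, so existential statements need an ambient type
  that is large enough.  The type \<open>'h ell2\<close> contains, up to a unitary, every Hilbert space that is
  the closed linear span of a countable union of images of \<open>'h\<close> under bounded operators, in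
  particular the space of every minimal lifting.
\<close>

definition square_summable :: "(nat \<Rightarrow> 'a::real_normed_vector) \<Rightarrow> bool" where
  "square_summable f \<longleftrightarrow> summable (\<lambda>n. (norm (f n))\<^sup>2)"

lemma square_summable_zero: "square_summable (\<lambda>n. 0)"
  by (simp add: square_summable_def)

lemma square_summable_add:
  assumes "square_summable f" "square_summable g"
  shows "square_summable (\<lambda>n. f n + g n)"
  unfolding square_summable_def
proof (rule summable_comparison_test')
  show "summable (\<lambda>n. 2 * (norm (f n))\<^sup>2 + 2 * (norm (g n))\<^sup>2)"
    using assms unfolding square_summable_def by (intro summable_add summable_mult)
  show "norm ((norm (f n + g n))\<^sup>2) \<le> 2 * (norm (f n))\<^sup>2 + 2 * (norm (g n))\<^sup>2" if "0 \<le> n" for n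
  proof -
    have "(norm (f n + g n))\<^sup>2 \<le> (norm (f n) + norm (g n))\<^sup>2"
      by (simp add: norm_triangle_ineq power_mono)
    also have "\<dots> \<le> 2 * (norm (f n))\<^sup>2 + 2 * (norm (g n))\<^sup>2"
      using sum_squares_ge_zero[of "norm (f n) - norm (g n)" 0]
      by (simp add: power2_eq_square algebra_simps)
    finally show ?thesis by simp
  qed
qed

lemma square_summable_bounded:
  assumes "square_summable f" "\<And>n. norm (g n) \<le> B * norm (f n)"
  shows "square_summable g"
  unfolding square_summable_def
proof (rule summable_comparison_test')
  show "summable (\<lambda>n. B\<^sup>2 * (norm (f n))\<^sup>2)"
    using assms(1) unfolding square_summable_def by (rule summable_mult)
  show "norm ((norm (g n))\<^sup>2) \<le> B\<^sup>2 * (norm (f n))\<^sup>2" if "0 \<le> n" for n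
    using power_mono[OF assms(2), of n 2] by (simp add: power_mult_distrib)
qed

lemma summable_inner:
  assumes "square_summable f" "square_summable g"
  shows "summable (\<lambda>n. inner (f n) (g n))"
proof (rule summable_comparison_test')
  show "summable (\<lambda>n. (norm (f n))\<^sup>2 + (norm (g n))\<^sup>2)"
    using assms unfolding square_summable_def by (rule summable_add)
  show "norm (inner (f n) (g n)) \<le> (norm (f n))\<^sup>2 + (norm (g n))\<^sup>2" if "0 \<le> n" for n
  proof -
    have "\<bar>inner (f n) (g n)\<bar> \<le> norm (f n) * norm (g n)" by (rule Cauchy_Schwarz_ineq2)
    also have "\<dots> \<le> (norm (f n))\<^sup>2 + (norm (g n))\<^sup>2"
      using sum_squares_bound[of "norm (f n)" "norm (g n)"]
        mult_nonneg_nonneg[OF norm_ge_zero[of "f n"] norm_ge_zero[of "g n"]]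
      by linarith
    finally show ?thesis by simp
  qed
qed

lemma norm_scaleC: "norm (c *\<^sub>C x) = cmod c * norm (x::'a::complex_inner)"
proof -
  have "cinner (c *\<^sub>C x) (c *\<^sub>C x) = c * cnj c * cinner x x"
    by (subst (1) cinner_scaleC_left, subst cinner_commute, subst cinner_scaleC_left)
      (simp only: complex_cnj_mult cinner_commute[of x x, symmetric] mult.assoc)
  then have "inner (c *\<^sub>C x) (c *\<^sub>C x) = (cmod c)\<^sup>2 * inner x x"
    by (simp add: inner_eq_Re_cinner flip: complex_norm_square of_real_power)
  then show ?thesis
    by (simp add: norm_eq_sqrt_inner real_sqrt_mult)
qed

lemma Im_cinner: "Im (cinner x y) = - inner (\<i> *\<^sub>C x) (y::'a::complex_inner)"
  by (simp add: inner_eq_Re_cinner cinner_scaleC_left)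

lemma summable_cinner:
  fixes f g :: "nat \<Rightarrow> 'a::complex_inner"
  assumes "square_summable f" "square_summable g"
  shows "summable (\<lambda>n. cinner (f n) (g n))"
proof -
  have "square_summable (\<lambda>n. \<i> *\<^sub>C f n)"
    by (rule square_summable_bounded[OF assms(1), of _ 1]) (simp add: norm_scaleC)
  then have "summable (\<lambda>n. Im (cinner (f n) (g n)))"
    unfolding Im_cinner by (intro summable_minus summable_inner assms(2))
  moreover have "summable (\<lambda>n. Re (cinner (f n) (g n)))"
    using summable_inner[OF assms] by (simp add: inner_eq_Re_cinner)
  ultimately show ?thesis by (simp add: summable_complex_iff)
qed

typedef (overloaded) 'a ell2 = "{f :: nat \<Rightarrow> 'a::real_normed_vector. square_summable f}"
  morphisms ell2_nth Abs_ell2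
  using square_summable_zero by auto

lemma square_summable_ell2_nth: "square_summable (ell2_nth x)"
  using ell2_nth[of x] by simp

lemma ell2_nth_Abs: "square_summable f \<Longrightarrow> ell2_nth (Abs_ell2 f) = f"
  by (simp add: Abs_ell2_inverse)

lemma ell2_eqI: "(\<And>n. ell2_nth x n = ell2_nth y n) \<Longrightarrow> x = y"
  by (metis ell2_nth_inject ext)

instantiation ell2 :: (real_normed_vector) real_vector
begin

definition "0 = Abs_ell2 (\<lambda>n. 0)"
definition "x + y = Abs_ell2 (\<lambda>n. ell2_nth x n + ell2_nth y n)"
definition "- x = Abs_ell2 (\<lambda>n. - ell2_nth x n)"
definition "x - y = Abs_ell2 (\<lambda>n. ell2_nth x n - ell2_nth y n)"
definition "r *\<^sub>R x = Abs_ell2 (\<lambda>n. r *\<^sub>R ell2_nth x n)"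

lemma ell2_nth_zero [simp]: "ell2_nth 0 n = 0"
  by (simp add: zero_ell2_def ell2_nth_Abs square_summable_zero)

lemma ell2_nth_add [simp]: "ell2_nth (x + y) n = ell2_nth x n + ell2_nth y n"
  by (simp add: plus_ell2_def ell2_nth_Abs square_summable_add square_summable_ell2_nth)

lemma ell2_nth_uminus [simp]: "ell2_nth (- x) n = - ell2_nth x n"
proof -
  have "square_summable (\<lambda>n. - ell2_nth x n)"
    by (rule square_summable_bounded[OF square_summable_ell2_nth, of _ 1 x]) simp
  then show ?thesis by (simp add: uminus_ell2_def ell2_nth_Abs)
qed

lemma ell2_nth_diff [simp]: "ell2_nth (x - y) n = ell2_nth x n - ell2_nth y n"
proof -
  have "square_summable (\<lambda>n. ell2_nth x n + ell2_nth (- y) n)"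
    by (intro square_summable_add square_summable_ell2_nth)
  then show ?thesis by (simp add: minus_ell2_def ell2_nth_Abs)
qed

lemma ell2_nth_scaleR [simp]: "ell2_nth (r *\<^sub>R x) n = r *\<^sub>R ell2_nth x n"
proof -
  have "square_summable (\<lambda>n. r *\<^sub>R ell2_nth x n)"
    by (rule square_summable_bounded[OF square_summable_ell2_nth, of _ "\<bar>r\<bar>" x]) simp
  then show ?thesis by (simp add: scaleR_ell2_def ell2_nth_Abs)
qed

instance
  by standard (auto intro!: ell2_eqI simp: algebra_simps)

end

instantiation ell2 :: (complex_inner) complex_inner
begin

definition "c *\<^sub>C x = Abs_ell2 (\<lambda>n. c *\<^sub>C ell2_nth x n)"
definition "cinner x y = (\<Sum>n. cinner (ell2_nth x n) (ell2_nth y n))"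
definition "inner x y = (\<Sum>n. inner (ell2_nth x n) (ell2_nth y n))"
definition "norm (x::'a ell2) = sqrt (inner x x)"
definition "sgn (x::'a ell2) = x /\<^sub>R norm x"
definition "dist (x::'a ell2) y = norm (x - y)"
definition "uniformity = (INF e\<in>{0<..}. principal {(x::'a ell2, y). dist x y < e})"
definition "open (U::'a ell2 set) \<longleftrightarrow>
  (\<forall>x\<in>U. eventually (\<lambda>(x', y). x' = x \<longrightarrow> y \<in> U) uniformity)"

lemma ell2_nth_scaleC [simp]: "ell2_nth (c *\<^sub>C x) n = c *\<^sub>C ell2_nth x n"
proof -
  have "square_summable (\<lambda>n. c *\<^sub>C ell2_nth x n)"
    by (rule square_summable_bounded[OF square_summable_ell2_nth, of _ "cmod c" x])
      (simp add: norm_scaleC)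
  then show ?thesis by (simp add: scaleC_ell2_def ell2_nth_Abs)
qed

lemma summable_inner_ell2: "summable (\<lambda>n. inner (ell2_nth x n) (ell2_nth y n))"
  by (intro summable_inner square_summable_ell2_nth)

lemma summable_cinner_ell2: "summable (\<lambda>n. cinner (ell2_nth x n) (ell2_nth y n))"
  by (intro summable_cinner square_summable_ell2_nth)

instance
proof
  fix x y z :: "'a ell2" and r :: real and c d :: complex
  show "dist x y = norm (x - y)" "sgn x = x /\<^sub>R norm x" "norm x = sqrt (inner x x)"
    by (simp_all add: dist_ell2_def sgn_ell2_def norm_ell2_def)
  show "uniformity = (INF e\<in>{0<..}. principal {(x::'a ell2, y). dist x y < e})"
    by (rule uniformity_ell2_def)
  show "open U \<longleftrightarrow> (\<forall>x\<in>U. eventually (\<lambda>(x', y). x' = x \<longrightarrow> y \<in> U) uniformity)"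
    for U :: "'a ell2 set"
    by (rule open_ell2_def)
  show "inner x y = inner y x"
    by (simp add: inner_ell2_def inner_commute)
  show "inner (x + y) z = inner x z + inner y z"
    by (simp add: inner_ell2_def inner_add_left suminf_add summable_inner_ell2)
  show "inner (r *\<^sub>R x) y = r * inner x y"
    by (simp add: inner_ell2_def suminf_mult summable_inner_ell2)
  show "0 \<le> inner x x"
    by (simp add: inner_ell2_def suminf_nonneg summable_inner_ell2)
  show "inner x x = 0 \<longleftrightarrow> x = 0"
  proof
    assume "inner x x = 0"
    then have "\<forall>n. inner (ell2_nth x n) (ell2_nth x n) = 0"
      using suminf_eq_zero_iff[OF summable_inner_ell2[of x x]] by (simp add: inner_ell2_def)
    then show "x = 0" by (auto intro: ell2_eqI)
  qed (simp add: inner_ell2_def)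
  show "c *\<^sub>C (x + y) = c *\<^sub>C x + c *\<^sub>C y" "(c + d) *\<^sub>C x = c *\<^sub>C x + d *\<^sub>C x"
    "c *\<^sub>C (d *\<^sub>C x) = (c * d) *\<^sub>C x" "r *\<^sub>R x = complex_of_real r *\<^sub>C x"
    by (auto intro!: ell2_eqI simp: scaleC_add_right scaleC_add_left scaleC_scaleC scaleR_scaleC)
  show "cinner x y = cnj (cinner y x)"
  proof -
    have "(\<lambda>n. cnj (cinner (ell2_nth y n) (ell2_nth x n))) sums cnj (cinner y x)"
      unfolding cinner_ell2_def sums_cnj by (intro summable_sums summable_cinner_ell2)
    then have "(\<lambda>n. cinner (ell2_nth x n) (ell2_nth y n)) sums cnj (cinner y x)"
      by (simp only: cinner_commute[symmetric])
    then show ?thesis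
      by (simp only: cinner_ell2_def[of x y] sums_iff)
  qed
  show "cinner (x + y) z = cinner x z + cinner y z"
    by (simp add: cinner_ell2_def cinner_add_left suminf_add summable_cinner_ell2)
  show "cinner (c *\<^sub>C x) y = c * cinner x y"
    by (simp add: cinner_ell2_def cinner_scaleC_left suminf_mult summable_cinner_ell2)
  show "inner x y = Re (cinner x y)"
    by (simp add: inner_ell2_def cinner_ell2_def inner_eq_Re_cinner Re_suminf summable_cinner_ell2)
qed

end

lemma norm_ell2_power2: "(norm x)\<^sup>2 = (\<Sum>n. (norm (ell2_nth (x::'a::complex_inner ell2) n))\<^sup>2)"
  by (simp add: power2_norm_eq_inner inner_ell2_def)

lemma sum_norm_ell2_le:
  "(\<Sum>n<N. (norm (ell2_nth (x::'a::complex_inner ell2) n))\<^sup>2) \<le> (norm x)\<^sup>2"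
  unfolding norm_ell2_power2
  using square_summable_ell2_nth[of x] by (intro sum_le_suminf) (auto simp: square_summable_def)

lemma norm_ell2_nth_le: "norm (ell2_nth x n) \<le> norm (x::'a::complex_inner ell2)"
proof -
  have "(norm (ell2_nth x n))\<^sup>2 \<le> (\<Sum>k<Suc n. (norm (ell2_nth x k))\<^sup>2)"
    by (simp add: sum_nonneg)
  also have "\<dots> \<le> (norm x)\<^sup>2" by (rule sum_norm_ell2_le)
  finally show ?thesis by (rule power2_le_imp_le) simp
qed

instance ell2 :: (chilbert_space) chilbert_space
proof
  fix X :: "nat \<Rightarrow> 'a ell2"
  assume X: "Cauchy X"
  have "Cauchy (\<lambda>m. ell2_nth (X m) n)" for n
  proof (rule metric_CauchyI)
    fix e :: real assume "0 < e"
    then obtain M where M: "\<And>m k. m \<ge> M \<Longrightarrow> k \<ge> M \<Longrightarrow> dist (X m) (X k) < e"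
      using X unfolding Cauchy_def by blast
    have "dist (ell2_nth (X m) n) (ell2_nth (X k) n) < e" if "m \<ge> M" "k \<ge> M" for m k
      using norm_ell2_nth_le[of "X m - X k" n] M[OF that] by (simp add: dist_norm)
    then show "\<exists>M. \<forall>m\<ge>M. \<forall>k\<ge>M. dist (ell2_nth (X m) n) (ell2_nth (X k) n) < e" by blast
  qed
  then have "\<forall>n. \<exists>l. (\<lambda>m. ell2_nth (X m) n) \<longlonglongrightarrow> l"
    by (simp add: Cauchy_convergent_iff convergent_def)
  from choice[OF this] obtain f where f: "\<And>n. (\<lambda>m. ell2_nth (X m) n) \<longlonglongrightarrow> f n"
    by blast
  have bound: "\<exists>M. \<forall>m\<ge>M. square_summable (\<lambda>n. ell2_nth (X m) n - f n) \<and>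
      (\<Sum>n. (norm (ell2_nth (X m) n - f n))\<^sup>2) \<le> e\<^sup>2" if "0 < e" for e :: real
  proof -
    obtain M where M: "\<And>m k. m \<ge> M \<Longrightarrow> k \<ge> M \<Longrightarrow> dist (X m) (X k) < e"
      using X \<open>0 < e\<close> unfolding Cauchy_def by blast
    have le: "(\<Sum>n<N. (norm (ell2_nth (X m) n - f n))\<^sup>2) \<le> e\<^sup>2" if "m \<ge> M" for m N
    proof (rule LIMSEQ_le_const2)
      show "(\<lambda>k. \<Sum>n<N. (norm (ell2_nth (X m) n - ell2_nth (X k) n))\<^sup>2)
          \<longlonglongrightarrow> (\<Sum>n<N. (norm (ell2_nth (X m) n - f n))\<^sup>2)"
        by (intro tendsto_intros f)
      have "(\<Sum>n<N. (norm (ell2_nth (X m) n - ell2_nth (X k) n))\<^sup>2) \<le> e\<^sup>2" if "k \<ge> M" for k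
      proof -
        have "(norm (X m - X k))\<^sup>2 \<le> e\<^sup>2"
          using M[OF \<open>m \<ge> M\<close> that] by (intro power_mono) (auto simp: dist_norm)
        then show ?thesis using sum_norm_ell2_le[where x = "X m - X k" and N = N] by simp
      qed
      then show "\<exists>K. \<forall>k\<ge>K. (\<Sum>n<N. (norm (ell2_nth (X m) n - ell2_nth (X k) n))\<^sup>2) \<le> e\<^sup>2"
        by blast
    qed
    have "square_summable (\<lambda>n. ell2_nth (X m) n - f n) \<and>
      (\<Sum>n. (norm (ell2_nth (X m) n - f n))\<^sup>2) \<le> e\<^sup>2" if "m \<ge> M" for m
    proof -
      have "summable (\<lambda>n. (norm (ell2_nth (X m) n - f n))\<^sup>2)"
        by (rule summableI_nonneg_bounded[OF _ le[OF that]]) simp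
      then show ?thesis
        using suminf_le_const[OF _ le[OF that]] by (simp add: square_summable_def)
    qed
    then show ?thesis by blast
  qed
  obtain M where "square_summable (\<lambda>n. ell2_nth (X M) n - f n)"
    using bound[of 1] by auto
  then have "square_summable (\<lambda>n. f n - ell2_nth (X M) n)"
    by (simp add: square_summable_def norm_minus_commute)
  from square_summable_add[OF this square_summable_ell2_nth[of "X M"]]
  have f_nth: "ell2_nth (Abs_ell2 f) = f" by (simp add: ell2_nth_Abs)
  have "X \<longlonglongrightarrow> Abs_ell2 f"
  proof (rule metric_LIMSEQ_I)
    fix e :: real assume "0 < e"
    then obtain M where M: "\<And>m. m \<ge> M \<Longrightarrow> (\<Sum>n. (norm (ell2_nth (X m) n - f n))\<^sup>2) \<le> (e/2)\<^sup>2"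
      using bound[of "e/2"] by auto
    have "dist (X m) (Abs_ell2 f) < e" if "m \<ge> M" for m
    proof -
      have "(norm (X m - Abs_ell2 f))\<^sup>2 \<le> (e/2)\<^sup>2"
        using M[OF that] by (simp add: norm_ell2_power2 f_nth)
      then have "norm (X m - Abs_ell2 f) \<le> e/2"
        by (rule power2_le_imp_le) (use \<open>0 < e\<close> in simp)
      then show ?thesis using \<open>0 < e\<close> by (simp add: dist_norm)
    qed
    then show "\<exists>M. \<forall>m\<ge>M. dist (X m) (Abs_ell2 f) < e" by blast
  qed
  then show "convergent X" by (auto simp: convergent_def)
qed

end

theory Submission
  imports Defs
begin

text \<open>
  Write \<open>S\<close> as an operator matrix with respect to \<open>\<K> = \<H> \<oplus> \<H>\<^sup>\<bottom>\<close>. The lifting property makes it lower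
  triangular, \<open>S (h + k) = T h + X h + Y k\<close>, and \<open>S\<^sup>* S \<H> \<subseteq> \<H>\<close> says that \<open>S\<^sup>* S = A \<oplus> B\<close> is block
  diagonal, with \<open>A = T\<^sup>* T + X\<^sup>* X\<close>. Quasi-isometry then reads \<open>A = T\<^sup>* A T + X\<^sup>* B X\<close> in the upper left
  corner. Left invertibility makes \<open>A\<close> and \<open>B\<close> invertible, so the two defects
  \<open>A - T\<^sup>* T = X\<^sup>* X\<close> and \<open>A - T\<^sup>* A T = X\<^sup>* B X\<close> dominate each other up to constants, which by
  Douglas' lemma means that their square roots have the same range
  (\<open>lifting_weight_if_lifting\<close>).

  Conversely, let \<open>D = (A - T\<^sup>* T)\<^sup>1\<^sup>/\<^sup>2\<close> and \<open>E = (A - T\<^sup>* A T)\<^sup>1\<^sup>/\<^sup>2\<close> have the same range. Douglas' lemma now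
  gives an invertible \<open>W\<close> on the closure of that range with \<open>W D = E\<close>, and on \<open>\<H>\<close> followed by
  countably many copies of this closure the weighted shift
  \<open>S (h, d\<^sub>0, d\<^sub>1, d\<^sub>2, \<dots>) = (T h, D h, W d\<^sub>0, d\<^sub>1, d\<^sub>2, \<dots>)\<close> satisfies
  \<open>S\<^sup>* S = A \<oplus> W\<^sup>* W \<oplus> 1 \<oplus> 1 \<oplus> \<dots>\<close>. It is left invertible and minimal since \<open>A\<close> and \<open>W\<close> are
  invertible, and quasi-isometric since \<open>A = T\<^sup>* A T + D W\<^sup>* W D\<close>
  (\<open>minimal_lifting_if_lifting_weight\<close>).

  The functional analysis behind both directions rests on two tools: a Riesz representation theorem
  relative to an operator (\<open>functional_representation\<close>), which yields adjoints, projections and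
  Douglas' lemma, and uniform boundedness (\<open>weakly_bounded_imp_bounded\<close>), which replaces the closed
  graph and open mapping theorems. Positive square roots come from a norm-convergent iteration.
\<close>

section \<open>From the complex to the real inner product\<close>

text \<open>
  A complex-linear identity between values of \<open>cinner\<close> follows from its real part, because the
  imaginary part is, up to sign, the real part at \<open>\<i> *\<^sub>C x\<close>. All analysis below is therefore carried out with
  the real inner product, and complex linearity is recorded as commutation with \<open>scaleC\<close>.
\<close>

instance chilbert_space \<subseteq> banach ..

lemma csubspace_imp_subspace: "csubspace V \<Longrightarrow> subspace V"
  by (auto simp: csubspace_def subspace_def scaleR_scaleC)

lemma csubspace_scaleC: "csubspace V \<Longrightarrow> x \<in> V \<Longrightarrow> c *\<^sub>C x \<in> V"
  by (auto simp: csubspace_def)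

lemma inner_scaleC_left: "inner (c *\<^sub>C x) y = inner x (cnj c *\<^sub>C (y::'a::complex_inner))"
proof -
  have "cinner (c *\<^sub>C x) y = cnj (cinner (cnj c *\<^sub>C y) x)"
    by (subst (2) cinner_scaleC_left) (simp add: cinner_scaleC_left flip: cinner_commute[of x y])
  then show ?thesis
    by (simp add: inner_eq_Re_cinner flip: cinner_commute[of x])
qed

lemma bounded_linear_scaleC: "bounded_linear (\<lambda>x::'a::complex_inner. c *\<^sub>C x)"
proof (rule bounded_linear_intro[where K="cmod c"])
  fix x y :: 'a and r
  show "c *\<^sub>C (x + y) = c *\<^sub>C x + c *\<^sub>C y" by (rule scaleC_add_right)
  show "c *\<^sub>C (r *\<^sub>R x) = r *\<^sub>R (c *\<^sub>C x)"
    by (simp add: scaleR_scaleC scaleC_scaleC mult.commute)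
  show "norm (c *\<^sub>C x) \<le> norm x * cmod c" by (simp add: norm_scaleC)
qed

lemma scaleC_zero: "c *\<^sub>C (0::'a::complex_inner) = 0"
  by (rule linear_simps(3)[OF bounded_linear_scaleC])

lemma cinner_zero: "cinner 0 (x::'a::complex_inner) = 0"
  using cinner_add_left[of 0 0 x] by simp

lemma cinner_eq_all_iff:
  assumes "\<And>c x. x \<in> V \<Longrightarrow> c *\<^sub>C x \<in> V"
    and "\<And>c x. x \<in> V \<Longrightarrow> F (c *\<^sub>C x) = c *\<^sub>C F x" "\<And>c x. x \<in> V \<Longrightarrow> G (c *\<^sub>C x) = c *\<^sub>C G x"
  shows "(\<forall>x\<in>V. cinner (F x) y = cinner (G x) z) \<longleftrightarrow> (\<forall>x\<in>V. inner (F x) y = inner (G x) z)"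
proof
  assume *: "\<forall>x\<in>V. inner (F x) y = inner (G x) z"
  show "\<forall>x\<in>V. cinner (F x) y = cinner (G x) z"
  proof
    fix x assume "x \<in> V"
    then have "inner (\<i> *\<^sub>C F x) y = inner (\<i> *\<^sub>C G x) z"
      using * assms(1)[of x \<i>] assms(2,3)[of x \<i>] by metis
    then show "cinner (F x) y = cinner (G x) z"
      using * \<open>x \<in> V\<close> by (simp add: complex_eq_iff Im_cinner flip: inner_eq_Re_cinner)
  qed
qed (simp add: inner_eq_Re_cinner)

lemma bounded_op_iff:
  "bounded_op T \<longleftrightarrow> bounded_linear T \<and> (\<forall>c x. T (c *\<^sub>C x) = c *\<^sub>C T x)"
proof
  assume T: "bounded_op T"
  then obtain B where "\<And>x. norm (T x) \<le> B * norm x" by (auto simp: bounded_op_on_def)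
  then have "bounded_linear T"
    using T by (intro bounded_linear_intro[where K=B])
      (auto simp: bounded_op_on_def scaleR_scaleC mult.commute)
  then show "bounded_linear T \<and> (\<forall>c x. T (c *\<^sub>C x) = c *\<^sub>C T x)"
    using T by (auto simp: bounded_op_on_def)
next
  assume T: "bounded_linear T \<and> (\<forall>c x. T (c *\<^sub>C x) = c *\<^sub>C T x)"
  then obtain B where "\<And>x. norm (T x) \<le> norm x * B"
    using bounded_linear.bounded by blast
  then have "\<exists>B. \<forall>x. norm (T x) \<le> B * norm x" by (metis mult.commute)
  then show "bounded_op T"
    using T by (auto simp: bounded_op_on_def linear_simps)
qed

lemma bounded_op_linear: "bounded_op T \<Longrightarrow> bounded_linear T"
  and bounded_op_scaleC: "bounded_op T \<Longrightarrow> T (c *\<^sub>C x) = c *\<^sub>C T x"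
  by (auto simp: bounded_op_iff)

lemma csubspace_range: "bounded_op D \<Longrightarrow> csubspace (range D)"
proof -
  assume D: "bounded_op D"
  then have D0: "D 0 = 0" by (simp add: bounded_op_linear linear_simps)
  have "D x + D y = D (x + y)" "c *\<^sub>C D x = D (c *\<^sub>C x)" for x y c
    using D by (simp_all add: bounded_op_linear linear_simps bounded_op_scaleC)
  then show ?thesis using rangeI[of D 0] D0 by (auto simp: csubspace_def)
qed

lemma csubspace_closure:
  assumes "csubspace V"
  shows "csubspace (closure V)"
proof -
  have lim: "u \<in> closure V \<longleftrightarrow> (\<exists>a. (\<forall>n. a n \<in> V) \<and> a \<longlonglongrightarrow> u)" for u
    by (rule closure_sequential)
  have "c *\<^sub>C x \<in> closure V" if x: "x \<in> closure V" for c x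
  proof -
    obtain a where a: "\<And>n. a n \<in> V" "a \<longlonglongrightarrow> x" using lim[THEN iffD1, OF x] by auto
    have "(\<lambda>n. c *\<^sub>C a n) \<longlonglongrightarrow> c *\<^sub>C x"
      by (rule bounded_linear.tendsto[OF bounded_linear_scaleC a(2)])
    moreover have "\<forall>n. c *\<^sub>C a n \<in> V" using a(1) csubspace_scaleC[OF assms] by simp
    ultimately show ?thesis unfolding lim by (intro exI conjI)
  qed
  moreover have "x + y \<in> closure V" if xy: "x \<in> closure V" "y \<in> closure V" for x y
  proof -
    obtain a b where ab: "\<And>n. a n \<in> V" "a \<longlonglongrightarrow> x" "\<And>n. b n \<in> V" "b \<longlonglongrightarrow> y"
      using lim[THEN iffD1, OF xy(1)] lim[THEN iffD1, OF xy(2)] by auto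
    have "\<forall>n. a n + b n \<in> V" using ab assms by (auto simp: csubspace_def)
    moreover have "(\<lambda>n. a n + b n) \<longlonglongrightarrow> x + y" by (intro tendsto_add ab)
    ultimately show ?thesis unfolding lim by (intro exI conjI)
  qed
  moreover have "0 \<in> closure V" using assms closure_subset by (auto simp: csubspace_def)
  ultimately show ?thesis by (simp add: csubspace_def)
qed

lemma bounded_op_compose: "bounded_op S \<Longrightarrow> bounded_op T \<Longrightarrow> bounded_op (S \<circ> T)"
  unfolding bounded_op_iff by (auto intro: bounded_linear_compose[unfolded o_def] simp: o_def)

lemma bounded_op_diff: "bounded_op S \<Longrightarrow> bounded_op T \<Longrightarrow> bounded_op (\<lambda>x. S x - T x)"
  unfolding bounded_op_iff
  by (auto intro: bounded_linear_sub
      simp: linear_simps(2)[OF bounded_linear_scaleC])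

text \<open>
  Symmetry comes from polarization: a complex form with real diagonal is Hermitian.
\<close>

lemma positive_op_iff:
  fixes B :: "'a::complex_inner \<Rightarrow> 'a"
  assumes "bounded_op B"
  shows "positive_op B \<longleftrightarrow>
    (\<forall>x y. inner (B x) y = inner x (B y)) \<and> (\<forall>x. 0 \<le> inner (B x) x)"
proof
  assume B: "positive_op B"
  have lin: "B (x + y) = B x + B y" for x y
    using bounded_op_linear[OF assms] by (simp add: linear_simps)
  have nonneg: "0 \<le> inner (B x) x" and Im0: "inner (\<i> *\<^sub>C B x) x = 0" for x
    using B by (auto simp: positive_op_def complex_nonneg_Reals_iff inner_eq_Re_cinner
        Im_cinner)
  have polar: "inner (\<i> *\<^sub>C B x) y + inner (\<i> *\<^sub>C B y) x = 0" for x y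
    using Im0[of "x + y"] Im0[of x] Im0[of y]
    by (simp add: lin scaleC_add_right inner_add_left inner_add_right)
  have "inner (B x) y = inner x (B y)" for x y
  proof -
    have "\<i> *\<^sub>C B (\<i> *\<^sub>C x) = - B x"
      using scaleR_scaleC[of "-1" "B x"] by (simp add: bounded_op_scaleC[OF assms] scaleC_scaleC)
    moreover have "inner (\<i> *\<^sub>C B y) (\<i> *\<^sub>C x) = inner (B y) x"
      using scaleR_scaleC[of "1" "x"] by (simp add: inner_scaleC_left scaleC_scaleC)
    ultimately show ?thesis
      using polar[of "\<i> *\<^sub>C x" y] by (simp add: inner_commute)
  qed
  with nonneg show "(\<forall>x y. inner (B x) y = inner x (B y)) \<and> (\<forall>x. 0 \<le> inner (B x) x)" by blast
next
  assume B: "(\<forall>x y. inner (B x) y = inner x (B y)) \<and> (\<forall>x. 0 \<le> inner (B x) x)"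
  show "positive_op B"
    unfolding positive_op_def
  proof
    fix x :: 'a
    have "(- \<i>) *\<^sub>C x = - (\<i> *\<^sub>C x)"
      using scaleR_scaleC[of "-1" "\<i> *\<^sub>C x"] by (simp add: scaleC_scaleC)
    then have "inner (\<i> *\<^sub>C B x) x = - inner (B x) (\<i> *\<^sub>C x)"
      by (simp add: inner_scaleC_left)
    moreover have "inner (\<i> *\<^sub>C B x) x = inner (B x) (\<i> *\<^sub>C x)"
      using B by (metis bounded_op_scaleC[OF assms] inner_commute)
    ultimately have "Im (cinner (B x) x) = 0" by (simp add: Im_cinner)
    moreover have "0 \<le> Re (cinner (B x) x)"
      unfolding inner_eq_Re_cinner[symmetric] using B by blast
    ultimately show "cinner (B x) x \<in> \<real>\<^sub>\<ge>\<^sub>0"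
      by (simp add: complex_nonneg_Reals_iff)
  qed
qed

section \<open>Representation of bounded functionals\<close>

text \<open>
  Riesz' theorem relative to \<open>D\<close>, by the variational argument: the vector is the limit of \<open>D (z n)\<close>
  for a minimizing sequence \<open>z\<close> of \<open>(norm (D x))\<^sup>2 - 2 * \<phi> x\<close> on \<open>V\<close>. With \<open>D\<close> the identity this
  yields adjoints and projections; with \<open>D\<close> an operator it yields preimages under the adjoint of \<open>D\<close>
  together with a bound for their norms.
\<close>

lemma functional_representation:
  fixes D :: "'a::real_vector \<Rightarrow> 'b::{real_inner,banach}" and \<phi> :: "'a \<Rightarrow> real"
  assumes V: "subspace V"
    and D: "\<And>x y. x \<in> V \<Longrightarrow> y \<in> V \<Longrightarrow> D (x + y) = D x + D y" "\<And>r x. x \<in> V \<Longrightarrow> D (r *\<^sub>R x) = r *\<^sub>R D x"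
    and \<phi>: "\<And>x y. x \<in> V \<Longrightarrow> y \<in> V \<Longrightarrow> \<phi> (x + y) = \<phi> x + \<phi> y" "\<And>r x. x \<in> V \<Longrightarrow> \<phi> (r *\<^sub>R x) = r * \<phi> x"
    and bound: "\<And>x. x \<in> V \<Longrightarrow> \<bar>\<phi> x\<bar> \<le> c * norm (D x)" and "0 \<le> c"
  shows "\<exists>y\<in>closure (D ` V). norm y \<le> c \<and> (\<forall>x\<in>V. \<phi> x = inner (D x) y)"
proof -
  note Vadd = subspace_add[OF V] and Vscale = subspace_scale[OF V]
  define Q where "Q x = (norm (D x))\<^sup>2 - 2 * \<phi> x" for x
  define m where "m = Inf (Q ` V)"
  have "- c\<^sup>2 \<le> Q x" if "x \<in> V" for x
    using bound[OF that] sum_squares_ge_zero[of "norm (D x) - c" 0]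
    by (simp add: Q_def power2_eq_square algebra_simps)
  then have bdd: "bdd_below (Q ` V)" by (meson bdd_belowI2)
  have m_le: "m \<le> Q x" if "x \<in> V" for x
    unfolding m_def using bdd that by (simp add: cINF_lower)
  have "\<exists>x\<in>V. Q x < m + 1 / Suc n" for n
    using cInf_lessD[of "Q ` V" "m + 1 / Suc n"] subspace_0[OF V] by (auto simp: m_def)
  then obtain z where zV: "\<And>n. z n \<in> V" and z: "\<And>n. Q (z n) < m + 1 / Suc n" by metis
  have Qz: "(\<lambda>n. Q (z n)) \<longlonglongrightarrow> m"
  proof (rule tendsto_sandwich)
    show "\<forall>\<^sub>F n in sequentially. m \<le> Q (z n)" using m_le zV by simp
    show "\<forall>\<^sub>F n in sequentially. Q (z n) \<le> m + 1 / Suc n" using z by (simp add: less_imp_le)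
    show "(\<lambda>n. m + 1 / Suc n) \<longlonglongrightarrow> m"
      using tendsto_add[OF tendsto_const LIMSEQ_inverse_real_of_nat, of m]
      by (simp add: inverse_eq_divide)
  qed auto
  \<comment> \<open>The parallelogram identity, applied to the midpoint, turns almost minimal values of
    \<open>Q\<close> into a small distance.\<close>
  have close: "(norm (D x - D y))\<^sup>2 \<le> 2 * (Q x - m) + 2 * (Q y - m)" if "x \<in> V" "y \<in> V" for x y
  proof -
    have "m \<le> Q ((1/2) *\<^sub>R (x + y))" using that by (intro m_le Vscale Vadd)
    also have "\<dots> = (norm (D x + D y))\<^sup>2 / 4 - \<phi> x - \<phi> y"
      using that by (simp add: Q_def D \<phi> Vadd power_mult_distrib power_divide
          add_divide_distrib)
    moreover have "(norm (D x - D y))\<^sup>2 = 2 * (norm (D x))\<^sup>2 + 2 * (norm (D y))\<^sup>2 - (norm (D x + D y))\<^sup>2"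
      by (simp add: power2_norm_eq_inner inner_add_left inner_add_right inner_diff_left
          inner_diff_right inner_commute)
    ultimately show ?thesis by (simp add: Q_def)
  qed
  have "Cauchy (\<lambda>n. D (z n))"
  proof (rule metric_CauchyI)
    fix e :: real assume "0 < e"
    then have "\<forall>\<^sub>F n in sequentially. Q (z n) < m + e\<^sup>2 / 4"
      using Qz by (intro order_tendstoD) auto
    then obtain N where N: "\<And>n. n \<ge> N \<Longrightarrow> Q (z n) < m + e\<^sup>2 / 4"
      by (auto simp: eventually_sequentially)
    have "dist (D (z i)) (D (z j)) < e" if "i \<ge> N" "j \<ge> N" for i j
    proof -
      have "(norm (D (z i) - D (z j)))\<^sup>2 < e\<^sup>2"
        using close[of "z i" "z j"] N[OF that(1)] N[OF that(2)] zV by (simp add: algebra_simps)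
      then show ?thesis using \<open>0 < e\<close> by (simp add: dist_norm power2_less_imp_less)
    qed
    then show "\<exists>M. \<forall>i\<ge>M. \<forall>j\<ge>M. dist (D (z i)) (D (z j)) < e" by blast
  qed
  then obtain y where y: "(\<lambda>n. D (z n)) \<longlonglongrightarrow> y"
    using Cauchy_convergent_iff convergent_def by blast
  have "y \<in> closure (D ` V)"
    unfolding closure_sequential using y zV by (intro exI[of _ "\<lambda>n. D (z n)"]) auto
  moreover have rep: "\<phi> x = inner (D x) y" if "x \<in> V" for x
  proof -
    define a where "a = inner y (D x) - \<phi> x"
    have min: "0 \<le> 2 * t * a + t\<^sup>2 * (norm (D x))\<^sup>2" for t
    proof -
      have "m \<le> Q (z n + t *\<^sub>R x)" for n
        using that zV by (intro m_le Vadd Vscale)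
      also have "Q (z n + t *\<^sub>R x) = Q (z n) + 2 * t * (inner (D (z n)) (D x) - \<phi> x) + t\<^sup>2 * (norm (D x))\<^sup>2" for n
        using that zV unfolding Q_def power2_norm_eq_inner
        by (simp add: D \<phi> Vscale inner_add_left inner_add_right inner_commute algebra_simps
            power2_eq_square)
      finally have "m \<le> Q (z n) + 2 * t * (inner (D (z n)) (D x) - \<phi> x) + t\<^sup>2 * (norm (D x))\<^sup>2" for n .
      moreover have "(\<lambda>n. Q (z n) + 2 * t * (inner (D (z n)) (D x) - \<phi> x) + t\<^sup>2 * (norm (D x))\<^sup>2)
          \<longlonglongrightarrow> m + 2 * t * a + t\<^sup>2 * (norm (D x))\<^sup>2"
        unfolding a_def by (intro tendsto_intros Qz y)
      ultimately have "m \<le> m + 2 * t * a + t\<^sup>2 * (norm (D x))\<^sup>2"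
        by (intro LIMSEQ_le_const) auto
      then show ?thesis by simp
    qed
    \<comment> \<open>The linear term in \<open>t\<close> has to vanish; \<open>t = - a / s\<close> makes the right-hand side of \<open>min\<close>
      equal to \<open>- a\<^sup>2 (s + 1) / s\<^sup>2\<close>.\<close>
    define s where "s = 1 + (norm (D x))\<^sup>2"
    have "s > 0" by (simp add: s_def add_pos_nonneg)
    have "0 \<le> (2 * (- a / s) * a + (- a / s)\<^sup>2 * (s - 1)) * s\<^sup>2"
      using min[of "- a / s"] by (simp add: s_def)
    also have "\<dots> = - (a\<^sup>2 * (s + 1))"
      using \<open>s > 0\<close> by (simp add: field_simps power2_eq_square)
    finally have "a\<^sup>2 * (s + 1) \<le> 0" by simp
    then have "a = 0" using \<open>s > 0\<close>
      by (smt (verit) mult_pos_pos zero_less_power2)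
    then show ?thesis by (simp add: a_def inner_commute)
  qed
  moreover have "norm y \<le> c"
  proof -
    have "(\<lambda>n. inner (D (z n)) y) \<longlonglongrightarrow> inner y y" "(\<lambda>n. c * norm (D (z n))) \<longlonglongrightarrow> c * norm y"
      by (intro tendsto_intros y)+
    moreover have "inner (D (z n)) y \<le> c * norm (D (z n))" for n
      using bound[OF zV[of n]] rep[OF zV[of n]] by simp
    ultimately have "inner y y \<le> c * norm y" by (intro LIMSEQ_le) auto
    then have "norm y * norm y \<le> c * norm y"
      by (simp flip: power2_norm_eq_inner power2_eq_square)
    then show ?thesis using \<open>0 \<le> c\<close> by (cases "y = 0") auto
  qed
  ultimately show ?thesis by blast
qed

section \<open>Weakly bounded sets\<close>

text \<open>
  The uniform boundedness principle for vectors, by a gliding hump instead of Baire's theorem. If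
  \<open>F\<close> contains vectors \<open>f n\<close> of norm above \<open>4 ^ n\<close>, then a series of multiples of them with norms
  \<open>(1/3) ^ n\<close> converges to some \<open>x\<close>. Choosing the sign of each term makes \<open>inner x (f n)\<close> at least
  a fixed multiple of \<open>(1/3) ^ n * norm (f n)\<close>, since all later terms together have at most half
  the norm of the \<open>n\<close>-th one.
\<close>

lemma weakly_bounded_imp_bounded:
  fixes F :: "'a::{real_inner,banach} set"
  assumes M: "subspace M" "closed M" and "F \<subseteq> M"
    and weak: "\<And>x. x \<in> M \<Longrightarrow> \<exists>B. \<forall>f\<in>F. \<bar>inner x f\<bar> \<le> B"
  shows "bounded F"
proof (rule ccontr)
  assume "\<not> bounded F"
  then have "\<exists>f\<in>F. norm f > 4 ^ n" for n :: nat
    by (metis bounded_iff not_le)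
  then obtain f where fF: "\<And>n. f n \<in> F" and f: "\<And>n. norm (f n) > 4 ^ n" by metis
  have f_pos: "norm (f n) > 0" for n
    using f[of n] by (smt (verit) zero_less_power)
  \<comment> \<open>The sign prevents cancellation against the value that has been reached so far.\<close>
  define step where "step n x = (if inner x (f n) \<ge> 0 then 1 else -1) *\<^sub>R ((1/3) ^ n / norm (f n)) *\<^sub>R f n" for n x
  define X where "X = rec_nat 0 (\<lambda>n x. x + step n x)"
  have X_Suc: "X (Suc n) = X n + step n (X n)" for n by (simp add: X_def)
  have step_norm: "norm (step n x) = (1/3) ^ n" for n x
    using f_pos[of n] by (simp add: step_def)
  have step_inner: "(1/3) ^ n * norm (f n) \<le> \<bar>inner (x + step n x) (f n)\<bar>" for n x
  proof -
    define w where "w = (1/3) ^ n * norm (f n)"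
    have "inner (step n x) (f n) = (if inner x (f n) \<ge> 0 then w else - w)"
      using f_pos[of n]
      by (simp add: step_def w_def power2_eq_square flip: power2_norm_eq_inner)
    moreover have "w \<ge> 0" by (simp add: w_def)
    ultimately have "w \<le> \<bar>inner (x + step n x) (f n)\<bar>"
      by (auto simp: inner_add_left)
    then show ?thesis by (simp add: w_def)
  qed
  have XM: "X n \<in> M" for n
  proof (induction n)
    case (Suc n)
    then show ?case using fF \<open>F \<subseteq> M\<close>
      by (auto simp: X_Suc step_def intro!: subspace_add[OF M(1)] subspace_diff[OF M(1)] subspace_scale[OF M(1)])
  qed (simp add: X_def subspace_0[OF M(1)])
  have far: "norm (X (k + n) - X n) \<le> (3/2) * (1/3) ^ n - (3/2) * (1/3) ^ (k + n)" for k n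
  proof (induction k)
    case (Suc k)
    have "norm (X (Suc k + n) - X n) \<le> norm (X (k + n) - X n) + norm (step (k + n) (X (k + n)))"
      using norm_triangle_ineq[of "X (k + n) - X n" "step (k + n) (X (k + n))"]
      by (simp add: X_Suc algebra_simps)
    also have "\<dots> \<le> (3/2) * (1/3) ^ n - (3/2) * (1/3) ^ (Suc k + n)"
      using Suc by (simp add: step_norm)
    finally show ?case .
  qed simp
  have far': "norm (X (k + n) - X n) \<le> (3/2) * (1/3) ^ n" for k n
  proof -
    have "0 \<le> (3/2) * (1/3::real) ^ (k + n)" by simp
    then show ?thesis using far[of k n] by linarith
  qed
  have "Cauchy X"
  proof (rule metric_CauchyI)
    fix e :: real assume "0 < e"
    have "(\<lambda>n. 3 * (1/3::real) ^ n) \<longlonglongrightarrow> 3 * 0" by (intro tendsto_intros LIMSEQ_power_zero) simp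
    then have "\<forall>\<^sub>F n in sequentially. 3 * (1/3::real) ^ n < e"
      using \<open>0 < e\<close> by (intro order_tendstoD) auto
    then obtain N where N: "3 * (1/3::real) ^ N < e" by (auto simp: eventually_sequentially)
    have *: "norm (X i - X N) < e / 2" if "i \<ge> N" for i
      using far'[of "i - N" N] that N by simp
    have "dist (X i) (X j) < e" if "i \<ge> N" "j \<ge> N" for i j
      using dist_triangle_half_l[of "X i" "X N" e "X j"] *[OF that(1)] *[OF that(2)]
      by (simp add: dist_norm norm_minus_commute)
    then show "\<exists>N. \<forall>i\<ge>N. \<forall>j\<ge>N. dist (X i) (X j) < e" by blast
  qed
  then obtain x where x: "X \<longlonglongrightarrow> x"
    using Cauchy_convergent_iff convergent_def by blast
  have "x \<in> M" using closed_sequentially[OF M(2)] XM x by blast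
  have "norm (x - X n) \<le> (3/2) * (1/3) ^ n" for n
  proof (rule LIMSEQ_le_const2)
    show "(\<lambda>k. norm (X (k + n) - X n)) \<longlonglongrightarrow> norm (x - X n)"
      by (intro tendsto_intros LIMSEQ_ignore_initial_segment x)
  qed (use far' in auto)
  from this[of "Suc n" for n] have near: "norm (x - X (Suc n)) \<le> (1/2) * (1/3) ^ n" for n by simp
  have "\<bar>inner x (f n)\<bar> \<ge> (1/2) * (4/3) ^ n" for n
  proof -
    have "\<bar>inner (X (Suc n)) (f n)\<bar> - \<bar>inner x (f n)\<bar> \<le> \<bar>inner (x - X (Suc n)) (f n)\<bar>"
      by (simp add: inner_diff_left)
    also have "\<dots> \<le> norm (x - X (Suc n)) * norm (f n)" by (rule Cauchy_Schwarz_ineq2)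
    also have "\<dots> \<le> (1/2) * (1/3) ^ n * norm (f n)" using near by (intro mult_right_mono) auto
    finally have "(1/2) * (1/3) ^ n * norm (f n) \<le> \<bar>inner x (f n)\<bar>"
      using step_inner[of n "X n"] by (simp add: X_Suc)
    moreover have "(1/2) * (1/3::real) ^ n * 4 ^ n \<le> (1/2) * (1/3) ^ n * norm (f n)"
      using f[of n] by (intro mult_left_mono) auto
    moreover have "(1/2) * (1/3::real) ^ n * 4 ^ n = (1/2) * (4/3) ^ n"
      by (simp add: power_divide)
    ultimately show ?thesis by linarith
  qed
  moreover obtain B where B: "\<And>n. \<bar>inner x (f n)\<bar> \<le> B" using weak[OF \<open>x \<in> M\<close>] fF by blast
  moreover obtain n where "(4/3::real) ^ n > 2 * B"
    using real_arch_pow[of "4/3" "2 * B"] by auto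
  ultimately show False using order_trans[of "(1/2) * (4/3) ^ n" "\<bar>inner x (f n)\<bar>" B] by fastforce
qed


section \<open>Adjoints\<close>

text \<open>
  The definite description is evaluated from real inner products; this is how \<open>S\<^sup>* S\<close> is computed
  for a concrete \<open>S\<close>.
\<close>

lemma adj_on_eqI:
  assumes K: "csubspace K" and S: "bounded_op_on K S"
    and z: "z \<in> K" "\<And>x. x \<in> K \<Longrightarrow> inner (S x) y = inner x z"
  shows "adj_on K S y = z"
  unfolding adj_on_def
proof (rule the_equality)
  have "(\<forall>x\<in>K. cinner (S x) y = cinner x w) \<longleftrightarrow> (\<forall>x\<in>K. inner (S x) y = inner x w)" for w
    using csubspace_scaleC[OF K] S
    by (intro cinner_eq_all_iff[where G="\<lambda>x. x"]) (auto simp: bounded_op_on_def)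
  then show "z \<in> K \<and> (\<forall>x\<in>K. cinner (S x) y = cinner x z)" using z by blast
  fix w assume w: "w \<in> K \<and> (\<forall>x\<in>K. cinner (S x) y = cinner x w)"
  then have "inner x w = inner x z" if "x \<in> K" for x
    using z that by (metis inner_eq_Re_cinner)
  then have "inner (w - z) (w - z) = 0"
    using w z(1) subspace_diff[OF csubspace_imp_subspace[OF K], of w z]
    by (simp add: inner_diff_right)
  then show "w = z" by simp
qed

lemma adj_on_props:
  fixes K :: "'a::chilbert_space set"
  assumes K: "csubspace K" "closed K" and S: "bounded_op_on K S"
  shows adj_on_mem: "adj_on K S y \<in> K"
    and inner_adj_on: "x \<in> K \<Longrightarrow> inner (S x) y = inner x (adj_on K S y)"
proof -
  obtain B where B: "\<And>x. x \<in> K \<Longrightarrow> norm (S x) \<le> B * norm x"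
    using S unfolding bounded_op_on_def by blast
  have S_scale: "S (r *\<^sub>R x) = r *\<^sub>R S x" if "x \<in> K" for r x
    using S that by (auto simp: bounded_op_on_def scaleR_scaleC)
  have "\<exists>z\<in>closure ((\<lambda>x. x) ` K). norm z \<le> \<bar>B\<bar> * norm y \<and> (\<forall>x\<in>K. inner (S x) y = inner x z)"
  proof (rule functional_representation[OF csubspace_imp_subspace[OF K(1)]])
    fix x assume "x \<in> K"
    have "\<bar>inner (S x) y\<bar> \<le> norm (S x) * norm y" by (rule Cauchy_Schwarz_ineq2)
    also have "\<dots> \<le> (\<bar>B\<bar> * norm x) * norm y"
      by (intro mult_right_mono order_trans[OF B[OF \<open>x \<in> K\<close>]]) auto
    finally show "\<bar>inner (S x) y\<bar> \<le> \<bar>B\<bar> * norm y * norm x" by (simp add: mult_ac)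
  qed (use S S_scale in \<open>auto simp: bounded_op_on_def inner_add_left\<close>)
  then obtain z where "z \<in> K" "\<forall>x\<in>K. inner (S x) y = inner x z"
    using K(2) by auto
  moreover from this have "adj_on K S y = z" by (intro adj_on_eqI K S) auto
  ultimately show "adj_on K S y \<in> K" "x \<in> K \<Longrightarrow> inner (S x) y = inner x (adj_on K S y)"
    by simp_all
qed

lemma csubspace_UNIV: "csubspace UNIV"
  by (simp add: csubspace_def)

lemma inner_adj:
  fixes T :: "'h::chilbert_space \<Rightarrow> 'h"
  shows "bounded_op T \<Longrightarrow> inner (T x) y = inner x (adj T y)"
  using inner_adj_on[of UNIV] csubspace_UNIV by auto

lemma adj_on_linear:
  fixes K :: "'a::chilbert_space set"
  assumes K: "csubspace K" "closed K" and S: "bounded_op_on K S"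
  shows "adj_on K S (x + y) = adj_on K S x + adj_on K S y"
    and "adj_on K S (c *\<^sub>C x) = c *\<^sub>C adj_on K S x"
    and "adj_on K S (r *\<^sub>R x) = r *\<^sub>R adj_on K S x"
proof -
  note mem = adj_on_mem[OF K S] and adj = inner_adj_on[OF K S, symmetric]
  note V = csubspace_imp_subspace[OF K(1)]
  show "adj_on K S (x + y) = adj_on K S x + adj_on K S y"
    by (rule adj_on_eqI[OF K(1) S]) (auto simp: mem adj inner_add_right intro: subspace_add[OF V])
  show "adj_on K S (r *\<^sub>R x) = r *\<^sub>R adj_on K S x"
    by (rule adj_on_eqI[OF K(1) S]) (auto simp: mem adj intro: subspace_scale[OF V])
  show "adj_on K S (c *\<^sub>C x) = c *\<^sub>C adj_on K S x"
  proof (rule adj_on_eqI[OF K(1) S])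
    fix z assume "z \<in> K"
    then have "inner (S (cnj c *\<^sub>C z)) x = inner (cnj c *\<^sub>C z) (adj_on K S x)"
      by (simp add: adj csubspace_scaleC[OF K(1)])
    then show "inner (S z) (c *\<^sub>C x) = inner z (c *\<^sub>C adj_on K S x)"
      using S \<open>z \<in> K\<close> by (simp add: bounded_op_on_def inner_scaleC_left)
  qed (simp add: mem csubspace_scaleC[OF K(1)])
qed

lemma bounded_op_adj:
  fixes T :: "'h::chilbert_space \<Rightarrow> 'h"
  assumes T: "bounded_op T"
  shows "bounded_op (adj T)"
proof -
  obtain B where B: "\<And>x. norm (T x) \<le> norm x * B" "B > 0"
    using bounded_linear.pos_bounded[OF bounded_op_linear[OF T]] by blast
  have "norm (adj T y) \<le> B * norm y" for y
  proof -
    have "norm (adj T y) * norm (adj T y) = inner (T (adj T y)) y"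
      by (simp add: inner_adj[OF T] flip: power2_norm_eq_inner power2_eq_square)
    also have "\<dots> \<le> norm (T (adj T y)) * norm y" by (rule norm_cauchy_schwarz)
    also have "\<dots> \<le> (norm (adj T y) * B) * norm y" by (intro mult_right_mono B) auto
    finally have "norm (adj T y) * norm (adj T y) \<le> norm (adj T y) * (B * norm y)"
      by (simp add: mult_ac)
    then show ?thesis using B(2) by (cases "adj T y = 0") auto
  qed
  then show ?thesis
    using adj_on_linear[OF csubspace_UNIV closed_UNIV T] by (auto simp: bounded_op_on_def)
qed


section \<open>Invertibility and lower bounds\<close>

text \<open>
  The bounded inverse theorem for an injective operator with closed range \<open>M\<close>, obtained from weak
  boundedness and duality. For \<open>x = S k\<close> in \<open>M\<close> the values \<open>inner x m = inner k (R m)\<close>, with \<open>R\<close> the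
  adjoint, are bounded by \<open>norm k\<close> as long as \<open>norm (R m) \<le> 1\<close>. As \<open>M\<close> is complete, such \<open>m\<close> are
  uniformly bounded, that is, \<open>R\<close> is bounded below on \<open>M\<close>. The representation theorem relative to
  \<open>R\<close> then solves \<open>S y = S x\<close> with control on the norm of \<open>y\<close>, and injectivity gives \<open>y = x\<close>.
\<close>

lemma left_invertible_on_bounded_below:
  fixes K :: "'a::chilbert_space set"
  assumes K: "csubspace K" "closed K" and S: "bounded_op_on K S" and inv: "left_invertible_on K S"
  shows "\<exists>c>0. \<forall>x\<in>K. c * norm x \<le> norm (S x)"
proof -
  note V = csubspace_imp_subspace[OF K(1)]
  have S_add: "S (x + y) = S x + S y" and S_scale: "S (r *\<^sub>R x) = r *\<^sub>R S x"
    if "x \<in> K" "y \<in> K" for x y r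
    using S that by (auto simp: bounded_op_on_def scaleR_scaleC)
  define M where "M = S ` K"
  have M: "subspace M" "closed M"
  proof -
    have "S 0 = 0" using S_scale[of 0 0 0] subspace_0[OF V] by simp
    then show "subspace M"
      unfolding M_def
      by (intro subspaceI)
        (auto simp: S_add[symmetric] S_scale[symmetric] intro!: imageI subspace_0[OF V]
          subspace_add[OF V] subspace_scale[OF V] intro: rev_image_eqI[OF subspace_0[OF V]])
    show "closed M" using inv by (simp add: left_invertible_on_def M_def)
  qed
  define R where "R = adj_on K S"
  have R: "inner (S x) y = inner x (R y)" "R y \<in> K" if "x \<in> K" for x y
    using inner_adj_on[OF K S that] adj_on_mem[OF K S] by (auto simp: R_def)
  have R_lin: "R (x + y) = R x + R y" "R (r *\<^sub>R x) = r *\<^sub>R R x" for x y r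
    using adj_on_linear[OF K S] by (auto simp: R_def)
  have "bounded {m \<in> M. norm (R m) \<le> 1}"
  proof (rule weakly_bounded_imp_bounded[OF M])
    fix x assume "x \<in> M"
    then obtain k where k: "k \<in> K" "x = S k" by (auto simp: M_def)
    have "\<bar>inner x m\<bar> \<le> norm k" if "norm (R m) \<le> 1" for m
    proof -
      have "\<bar>inner x m\<bar> \<le> norm k * norm (R m)"
        using Cauchy_Schwarz_ineq2[of k "R m"] k by (simp add: R)
      also have "\<dots> \<le> norm k * 1" using that by (intro mult_left_mono) auto
      finally show ?thesis by simp
    qed
    then show "\<exists>B. \<forall>m\<in>{m \<in> M. norm (R m) \<le> 1}. \<bar>inner x m\<bar> \<le> B" by blast
  qed auto
  then obtain c where c: "c > 0" "\<And>m. m \<in> M \<Longrightarrow> norm (R m) \<le> 1 \<Longrightarrow> norm m \<le> c"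
    by (auto simp: bounded_pos)
  have below: "norm m \<le> c * norm (R m)" if "m \<in> M" for m
  proof (cases "R m = 0")
    case True
    obtain k where "k \<in> K" "m = S k" using \<open>m \<in> M\<close> by (auto simp: M_def)
    then have "inner m m = 0" using R(1)[of k m] True by simp
    then show ?thesis using c(1) by simp
  next
    case False
    have "norm ((1 / norm (R m)) *\<^sub>R m) \<le> c"
      using False that by (intro c) (auto simp: R_lin intro: subspace_scale[OF M(1)])
    then show ?thesis using False by (simp add: field_simps)
  qed
  have "norm x \<le> c * norm (S x)" if "x \<in> K" for x
  proof -
    have "\<exists>y\<in>closure (R ` M). norm y \<le> c * norm (S x) \<and> (\<forall>m\<in>M. inner m (S x) = inner (R m) y)"
    proof (rule functional_representation[OF M(1)])
      fix m assume "m \<in> M"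
      have "\<bar>inner m (S x)\<bar> \<le> norm m * norm (S x)" by (rule Cauchy_Schwarz_ineq2)
      also have "\<dots> \<le> c * norm (R m) * norm (S x)"
        using below[OF \<open>m \<in> M\<close>] by (intro mult_right_mono) auto
      finally show "\<bar>inner m (S x)\<bar> \<le> c * norm (S x) * norm (R m)" by (simp add: mult_ac)
    qed (use c(1) in \<open>auto simp: R_lin inner_add_left\<close>)
    then obtain y where y: "y \<in> closure (R ` M)" "norm y \<le> c * norm (S x)"
      "\<And>m. m \<in> M \<Longrightarrow> inner m (S x) = inner (R m) y" by blast
    have "R ` M \<subseteq> K" using R(2)[OF that] by blast
    then have "y \<in> K" using y(1) K(2) closure_minimal by blast
    have "S x - S y \<in> M"
      using that \<open>y \<in> K\<close> by (intro subspace_diff[OF M(1)]) (auto simp: M_def)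
    then have "inner (S x - S y) (S x - S y) = 0"
      using y(3)[of "S x - S y"] R(1)[OF \<open>y \<in> K\<close>, of "S x - S y"]
      by (simp add: inner_diff_right inner_commute)
    then have "S x = S y" by simp
    then have "x = y"
      using inv that \<open>y \<in> K\<close> by (auto simp: left_invertible_on_def inj_on_def)
    then show ?thesis using y(2) by simp
  qed
  then show ?thesis using c(1) by (intro exI[of _ "1 / c"]) (auto simp: field_simps)
qed

text \<open>
  Surjectivity is the representation theorem relative to \<open>A\<close> itself: a vector that represents
  \<open>x \<mapsto> inner x g\<close> along \<open>A\<close> is a preimage of \<open>g\<close>, by symmetry.
\<close>

lemma invertible_op_if_coercive:
  fixes A :: "'h::chilbert_space \<Rightarrow> 'h"
  assumes A: "bounded_op A" and sym: "\<And>x y. inner (A x) y = inner x (A y)"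
    and "c > 0" and coercive: "\<And>x. c * (norm x)\<^sup>2 \<le> inner (A x) x"
  shows "invertible_op A"
proof -
  note lin = linear_simps[OF bounded_op_linear[OF A]]
  have below: "c * norm x \<le> norm (A x)" for x
  proof -
    have "(c * norm x) * norm x \<le> norm (A x) * norm x"
      using coercive[of x] norm_cauchy_schwarz[of "A x" x] by (simp add: power2_eq_square mult_ac)
    then show ?thesis by (cases "x = 0") auto
  qed
  have surj: "\<exists>y. A y = g" for g
  proof -
    have "\<exists>y\<in>closure (A ` UNIV). norm y \<le> norm g / c \<and> (\<forall>x\<in>UNIV. inner x g = inner (A x) y)"
    proof (rule functional_representation)
      fix x
      have "\<bar>inner x g\<bar> \<le> norm x * norm g" by (rule Cauchy_Schwarz_ineq2)
      also have "\<dots> \<le> (norm (A x) / c) * norm g"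
        using below[of x] \<open>c > 0\<close> by (intro mult_right_mono) (auto simp: field_simps)
      finally show "\<bar>inner x g\<bar> \<le> norm g / c * norm (A x)" by (simp add: mult_ac)
    qed (use \<open>c > 0\<close> in \<open>auto simp: lin inner_add_left\<close>)
    then obtain y where "\<And>x. inner x g = inner x (A y)" by (auto simp: sym)
    then show ?thesis by (metis inner_eq_zero_iff inner_diff_right right_minus_eq)
  qed
  then obtain B where AB: "\<And>g. A (B g) = g" by metis
  have inj: "x = y" if "A x = A y" for x y
    using below[of "x - y"] that \<open>c > 0\<close> by (simp add: lin mult_le_0_iff)
  have "bounded_op B"
    unfolding bounded_op_on_def
  proof (intro conjI ballI allI exI)
    fix x y :: 'h and r
    show "B (x + y) = B x + B y" by (rule inj) (simp add: lin AB)
    show "B (r *\<^sub>C x) = r *\<^sub>C B x" by (rule inj) (simp add: bounded_op_scaleC[OF A] AB)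
    show "norm (B x) \<le> (1 / c) * norm x"
      using below[of "B x"] \<open>c > 0\<close> by (simp add: AB field_simps)
  qed auto
  moreover have "B (A x) = x" for x by (rule inj) (simp add: AB)
  ultimately show ?thesis using A AB by (auto simp: invertible_op_def fun_eq_iff)
qed

lemma positive_Cauchy_Schwarz:
  fixes A :: "'a::real_inner \<Rightarrow> 'a"
  assumes "linear A" and sym: "\<And>x y. inner (A x) y = inner x (A y)" and pos: "\<And>x. 0 \<le> inner (A x) x"
  shows "(inner (A x) y)\<^sup>2 \<le> inner (A x) x * inner (A y) y"
proof -
  define a b d where "a = inner (A x) x" "b = inner (A x) y" "d = inner (A y) y"
  have quad: "0 \<le> s\<^sup>2 * a + 2 * s * t * b + t\<^sup>2 * d" for s t
  proof -
    have "0 \<le> inner (A (s *\<^sub>R x + t *\<^sub>R y)) (s *\<^sub>R x + t *\<^sub>R y)" by (rule pos)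
    also have "\<dots> = s\<^sup>2 * a + 2 * s * t * b + t\<^sup>2 * d"
      using sym[of y x] unfolding a_b_d_def linear_add[OF assms(1)] linear_scale[OF assms(1)]
      by (simp add: inner_add_left inner_add_right inner_commute power2_eq_square algebra_simps)
    finally show ?thesis .
  qed
  have "a \<ge> 0" "d \<ge> 0" using pos by (auto simp: a_b_d_def)
  have "b\<^sup>2 \<le> a * d"
  proof (cases "d = 0")
    case True
    \<comment> \<open>At \<open>s = b\<close> and \<open>t = - (a + 1)\<close> the form is \<open>- b\<^sup>2 (a + 2)\<close>, so \<open>b\<close> vanishes.\<close>
    have "0 \<le> b\<^sup>2 * a" using \<open>a \<ge> 0\<close> by simp
    then show ?thesis using quad[of b "- (a + 1)"] True
      by (simp add: power2_eq_square algebra_simps)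
  next
    case False
    then have "d > 0" using \<open>d \<ge> 0\<close> by simp
    have "0 \<le> d * (a * d - b\<^sup>2)"
      using quad[of d "- b"] by (simp add: power2_eq_square algebra_simps)
    then show ?thesis using \<open>d > 0\<close> by (simp add: zero_le_mult_iff)
  qed
  then show ?thesis by (simp add: a_b_d_def)
qed

text \<open>
  The Cauchy--Schwarz inequality for the form of \<open>A\<close>, applied to \<open>x\<close> and its preimage, bounds
  \<open>(norm x) ^ 4\<close> by \<open>inner (A x) x\<close> times a multiple of \<open>(norm x)\<^sup>2\<close>.
\<close>

lemma coercive_if_invertible_op:
  fixes A :: "'h::chilbert_space \<Rightarrow> 'h"
  assumes A: "invertible_op A" and sym: "\<And>x y. inner (A x) y = inner x (A y)"
    and pos: "\<And>x. 0 \<le> inner (A x) x"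
  shows "\<exists>c>0. \<forall>x. c * (norm x)\<^sup>2 \<le> inner (A x) x"
proof -
  obtain B where B: "bounded_op B" "\<And>x. A (B x) = x" and "bounded_op A"
    using A by (auto simp: invertible_op_def fun_eq_iff)
  have "linear A" using bounded_op_linear[OF \<open>bounded_op A\<close>] by (rule bounded_linear.linear)
  obtain b where b: "b > 0" "\<And>x. norm (B x) \<le> norm x * b"
    using bounded_linear.pos_bounded[OF bounded_op_linear[OF B(1)]] by blast
  have "(1 / b) * (norm x)\<^sup>2 \<le> inner (A x) x" for x
  proof (cases "x = 0")
    case False
    have "(inner (A x) (B x))\<^sup>2 \<le> inner (A x) x * inner (A (B x)) (B x)"
      by (rule positive_Cauchy_Schwarz[OF \<open>linear A\<close> sym pos])
    moreover have "inner (A x) (B x) = (norm x)\<^sup>2" by (simp add: sym B(2) power2_norm_eq_inner)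
    ultimately have "((norm x)\<^sup>2)\<^sup>2 \<le> inner (A x) x * inner x (B x)"
      by (simp add: B(2))
    also have "\<dots> \<le> inner (A x) x * (norm x * norm (B x))"
      by (intro mult_left_mono norm_cauchy_schwarz pos)
    also have "\<dots> \<le> inner (A x) x * (norm x * (norm x * b))"
      by (intro mult_left_mono b pos) auto
    finally have "(norm x)\<^sup>2 * (norm x)\<^sup>2 \<le> (inner (A x) x * b) * (norm x)\<^sup>2"
      by (simp add: power2_eq_square mult_ac)
    then have "(norm x)\<^sup>2 \<le> inner (A x) x * b"
      by (rule mult_right_le_imp_le) (use False in simp)
    then show ?thesis using b(1) by (simp add: field_simps)
  qed simp
  then show ?thesis using b(1) by (intro exI[of _ "1 / b"]) auto
qed


section \<open>Ranges of symmetric operators\<close>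

text \<open>
  Douglas' lemma: for symmetric \<open>C\<close> and \<open>D\<close> the inclusion of ranges is equivalent to the domination
  of norms, and the latter produces an operator \<open>W\<close> with \<open>W \<circ> D = C\<close>.
\<close>

lemma range_subset_if_norm_le:
  fixes C D :: "'h::{real_inner,banach} \<Rightarrow> 'h"
  assumes C: "linear C" "\<And>x y. inner (C x) y = inner x (C y)"
    and D: "linear D" "\<And>x y. inner (D x) y = inner x (D y)"
    and le: "\<And>x. norm (C x) \<le> c * norm (D x)" and "0 \<le> c"
  shows "range C \<subseteq> range D"
proof clarify
  fix x
  have "\<exists>y\<in>closure (D ` UNIV). norm y \<le> c * norm x \<and> (\<forall>z\<in>UNIV. inner (C z) x = inner (D z) y)"
  proof (rule functional_representation)
    fix z
    have "\<bar>inner (C z) x\<bar> \<le> norm (C z) * norm x" by (rule Cauchy_Schwarz_ineq2)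
    also have "\<dots> \<le> c * norm (D z) * norm x" using le by (intro mult_right_mono) auto
    finally show "\<bar>inner (C z) x\<bar> \<le> c * norm x * norm (D z)" by (simp add: mult_ac)
  qed (use \<open>0 \<le> c\<close> in \<open>auto simp: linear_add[OF C(1)] linear_add[OF D(1)] linear_scale[OF C(1)] linear_scale[OF D(1)] inner_add_left\<close>)
  then obtain y where "\<And>z. inner z (C x) = inner z (D y)" by (auto simp: C D)
  then have "C x = D y" by (metis inner_eq_zero_iff inner_diff_right right_minus_eq)
  then show "C x \<in> range D" by blast
qed

text \<open>
  If \<open>C x = D y\<close>, then \<open>inner x (C z) = inner y (D z)\<close> for all \<open>z\<close>. Hence the vectors \<open>C z\<close> with
  \<open>norm (D z) \<le> 1\<close> are weakly bounded.
\<close>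

lemma norm_le_if_range_subset:
  fixes C D :: "'h::{real_inner,banach} \<Rightarrow> 'h"
  assumes C: "linear C" "\<And>x y. inner (C x) y = inner x (C y)"
    and D: "linear D" "\<And>x y. inner (D x) y = inner x (D y)"
    and sub: "range C \<subseteq> range D"
  shows "\<exists>c>0. \<forall>x. norm (C x) \<le> c * norm (D x)"
proof -
  have wit: "\<exists>y. \<forall>z. inner x (C z) = inner y (D z)" for x
    using sub by (metis C(2) D(2) rangeE rangeI subsetD)
  have "bounded (C ` {z. norm (D z) \<le> 1})"
  proof (rule weakly_bounded_imp_bounded[of UNIV])
    fix x
    obtain y where y: "\<And>z. inner x (C z) = inner y (D z)" using wit by blast
    have "\<bar>inner x (C z)\<bar> \<le> norm y" if "norm (D z) \<le> 1" for z
    proof -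
      have "\<bar>inner x (C z)\<bar> \<le> norm y * norm (D z)" unfolding y by (rule Cauchy_Schwarz_ineq2)
      also have "\<dots> \<le> norm y * 1" using that by (intro mult_left_mono) auto
      finally show ?thesis by simp
    qed
    then show "\<exists>B. \<forall>f\<in>C ` {z. norm (D z) \<le> 1}. \<bar>inner x f\<bar> \<le> B" by blast
  qed auto
  then obtain c where c: "c > 0" "\<And>z. norm (D z) \<le> 1 \<Longrightarrow> norm (C z) \<le> c"
    by (auto simp: bounded_pos)
  have "norm (C x) \<le> c * norm (D x)" for x
  proof (cases "D x = 0")
    case True
    obtain y where "\<And>z. inner (C x) (C z) = inner y (D z)" using wit by blast
    then have "inner (C x) (C x) = 0" using True by simp
    then show ?thesis using c(1) by simp
  next
    case False
    have "norm (C ((1 / norm (D x)) *\<^sub>R x)) \<le> c"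
      using False by (intro c) (simp add: linear_scale[OF D(1)])
    then show ?thesis using False by (simp add: linear_scale[OF C(1)] field_simps)
  qed
  then show ?thesis using c(1) by blast
qed

text \<open>
  Extending \<open>D x \<mapsto> C x\<close> to the whole space by continuity is avoided by dualizing: the
  representation theorem gives \<open>V\<close> with \<open>inner (C z) x = inner (D z) (V x)\<close>, and \<open>W\<close> is the adjoint
  of \<open>V\<close>. Linearity of \<open>V\<close> holds because its values are chosen in the closure of the range of \<open>D\<close>,
  where they are unique.
\<close>

lemma bounded_op_factor:
  fixes C D :: "'h::chilbert_space \<Rightarrow> 'h"
  assumes C: "bounded_op C" and D: "bounded_op D" and le: "\<And>x. norm (C x) \<le> c * norm (D x)"
    and "0 \<le> c"
  shows "\<exists>W. bounded_op W \<and> (\<forall>x. W (D x) = C x)"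
proof -
  note C_lin = linear_simps[OF bounded_op_linear[OF C]]
  note D_lin = linear_simps[OF bounded_op_linear[OF D]]
  have "\<exists>y\<in>closure (D ` UNIV). norm y \<le> c * norm x \<and> (\<forall>z\<in>UNIV. inner (C z) x = inner (D z) y)" for x
  proof (rule functional_representation)
    fix z
    have "\<bar>inner (C z) x\<bar> \<le> norm (C z) * norm x" by (rule Cauchy_Schwarz_ineq2)
    also have "\<dots> \<le> c * norm (D z) * norm x" using le by (intro mult_right_mono) auto
    finally show "\<bar>inner (C z) x\<bar> \<le> c * norm x * norm (D z)" by (simp add: mult_ac)
  qed (use \<open>0 \<le> c\<close> in \<open>auto simp: C_lin D_lin inner_add_left\<close>)
  then have "\<forall>x. \<exists>y. y \<in> closure (range D) \<and> norm y \<le> c * norm x \<and> (\<forall>z. inner (C z) x = inner (D z) y)"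
    by blast
  from choice[OF this] obtain V where V: "\<And>x. V x \<in> closure (range D)"
    "\<And>x. norm (V x) \<le> c * norm x" "\<And>x z. inner (C z) x = inner (D z) (V x)"
    by blast
  have uniq: "u = v" if "u \<in> closure (range D)" "v \<in> closure (range D)"
    "\<And>z. inner (D z) u = inner (D z) v" for u v
  proof -
    have "range D \<subseteq> {w. inner w (u - v) = 0}" using that(3) by (auto simp: inner_diff_right)
    moreover have "closed {w. inner w (u - v) = 0}"
      by (intro closed_Collect_eq continuous_intros)
    ultimately have sub: "closure (range D) \<subseteq> {w. inner w (u - v) = 0}" by (rule closure_minimal)
    have "inner (u - v) (u - v) = 0"
      using subsetD[OF sub that(1)] subsetD[OF sub that(2)] by (simp add: inner_diff_left)
    then show ?thesis by simp
  qed
  have "csubspace (closure (range D))" by (intro csubspace_closure csubspace_range D)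
  note cl = csubspace_imp_subspace[OF this] csubspace_scaleC[OF this]
  have "bounded_op V"
    unfolding bounded_op_on_def
  proof (intro conjI ballI allI exI)
    fix x y :: 'h and r
    show "V (x + y) = V x + V y"
      by (rule uniq) (auto simp: V(1) V(3)[symmetric] inner_add_right intro: subspace_add[OF cl(1)])
    show "V (r *\<^sub>C x) = r *\<^sub>C V x"
    proof (rule uniq)
      fix z show "inner (D z) (V (r *\<^sub>C x)) = inner (D z) (r *\<^sub>C V x)"
        using V(3)[of "cnj r *\<^sub>C z" x] V(3)[of z "r *\<^sub>C x"]
        by (simp add: bounded_op_scaleC[OF C] bounded_op_scaleC[OF D] inner_scaleC_left)
    qed (simp_all add: V(1) cl(2))
    show "norm (V x) \<le> c * norm x" by (rule V)
  qed auto
  have "adj V (D z) = C z" for z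
    using \<open>bounded_op V\<close> V(3) by (intro adj_on_eqI csubspace_UNIV) (auto simp: inner_commute)
  then show ?thesis using bounded_op_adj[OF \<open>bounded_op V\<close>] by blast
qed


section \<open>Positive square roots\<close>

text \<open>
  If \<open>C\<close> is a symmetric contraction and \<open>Y = (C + Y\<^sup>2) / 2\<close>, then \<open>(1 - Y)\<^sup>2 = 1 - C\<close>. The fixed point
  \<open>Y\<close> is the limit of the iteration started at \<open>0\<close>. Its convergence in norm, even where
  \<open>norm C = 1\<close>, is read off the same iteration for the number \<open>1\<close>: the iterates are polynomials
  in \<open>C\<close> whose coefficients, and those of their successive differences, are nonnegative, so norms
  are dominated by the values of the polynomials at \<open>1\<close>. Every operator that commutes with \<open>C\<close>
  commutes with \<open>Y\<close>; this gives both complex linearity and uniqueness of the square root.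
\<close>

lemma blinfun_compose_assoc: "(A o\<^sub>L B) o\<^sub>L C = A o\<^sub>L (B o\<^sub>L C)"
  by (rule blinfun_eqI) simp

primrec sqrt_iter :: "('a::real_normed_vector \<Rightarrow>\<^sub>L 'a) \<Rightarrow> nat \<Rightarrow> ('a \<Rightarrow>\<^sub>L 'a)" where
  "sqrt_iter C 0 = 0"
| "sqrt_iter C (Suc n) = (1/2) *\<^sub>R (C + (sqrt_iter C n o\<^sub>L sqrt_iter C n))"

primrec scalar_iter :: "nat \<Rightarrow> real" where
  "scalar_iter 0 = 0"
| "scalar_iter (Suc n) = (1 + (scalar_iter n)\<^sup>2) / 2"

lemma scalar_iter_bounds: "0 \<le> scalar_iter n \<and> scalar_iter n \<le> 1"
proof (induction n)
  case (Suc n)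
  then show ?case using power_le_one[of "scalar_iter n" 2] by simp
qed simp

lemma incseq_scalar_iter: "incseq scalar_iter"
proof (rule incseq_SucI)
  fix n show "scalar_iter n \<le> scalar_iter (Suc n)"
    using sum_squares_ge_zero[of "scalar_iter n - 1" 0] by (simp add: power2_eq_square algebra_simps)
qed

lemma sqrt_iter_commute:
  assumes "X o\<^sub>L C = C o\<^sub>L X"
  shows "X o\<^sub>L sqrt_iter C n = sqrt_iter C n o\<^sub>L X"
proof (induction n)
  case (Suc n)
  let ?Y = "sqrt_iter C n"
  have "X o\<^sub>L (?Y o\<^sub>L ?Y) = (?Y o\<^sub>L ?Y) o\<^sub>L X"
    using Suc by (metis blinfun_compose_assoc)
  then show ?case
    using assms by (simp add: bounded_bilinear.scaleR_left[OF bounded_bilinear_blinfun_compose]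
      bounded_bilinear.scaleR_right[OF bounded_bilinear_blinfun_compose]
      bounded_bilinear.add_left[OF bounded_bilinear_blinfun_compose]
      bounded_bilinear.add_right[OF bounded_bilinear_blinfun_compose])
qed (simp add: blinfun_eqI)

lemma norm_sqrt_iter_le:
  assumes "norm C \<le> 1"
  shows "norm (sqrt_iter C n) \<le> scalar_iter n"
proof (induction n)
  case (Suc n)
  have "norm (C + (sqrt_iter C n o\<^sub>L sqrt_iter C n)) \<le> 1 + scalar_iter n * scalar_iter n"
    using norm_triangle_ineq[of C "sqrt_iter C n o\<^sub>L sqrt_iter C n"] assms
      norm_blinfun_compose[of "sqrt_iter C n" "sqrt_iter C n"]
      mult_mono[OF Suc Suc] scalar_iter_bounds[of n] by simp
  then show ?case by (simp add: power2_eq_square)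
qed simp

text \<open>
  With \<open>U\<close> and \<open>V\<close> two consecutive iterates, \<open>U\<^sup>2 - V\<^sup>2 = (U - V) (U + V)\<close> since they commute.
\<close>

lemma norm_sqrt_iter_diff_le:
  assumes C: "norm C \<le> 1"
  shows "norm (sqrt_iter C (Suc n) - sqrt_iter C n) \<le> scalar_iter (Suc n) - scalar_iter n"
proof (induction n)
  case (Suc n)
  define U V u v where "U = sqrt_iter C (Suc n)" and "V = sqrt_iter C n"
    and "u = scalar_iter (Suc n)" and "v = scalar_iter n"
  have "C o\<^sub>L V = V o\<^sub>L C" unfolding V_def by (rule sqrt_iter_commute) simp
  then have "V o\<^sub>L U = U o\<^sub>L V" unfolding U_def by (intro sqrt_iter_commute) simp
  then have "(U o\<^sub>L U) - (V o\<^sub>L V) = (U - V) o\<^sub>L (U + V)"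
    by (simp add: bounded_bilinear.add_right[OF bounded_bilinear_blinfun_compose]
        bounded_bilinear.diff_left[OF bounded_bilinear_blinfun_compose])
  moreover have "sqrt_iter C (Suc (Suc n)) - sqrt_iter C (Suc n) = (1/2) *\<^sub>R ((U o\<^sub>L U) - (V o\<^sub>L V))"
    unfolding U_def V_def by (simp add: algebra_simps)
  ultimately have "norm (sqrt_iter C (Suc (Suc n)) - sqrt_iter C (Suc n))
      = norm ((U - V) o\<^sub>L (U + V)) / 2" by simp
  also have "norm ((U - V) o\<^sub>L (U + V)) \<le> norm (U - V) * norm (U + V)"
    by (rule norm_blinfun_compose)
  also have "\<dots> \<le> (u - v) * (u + v)"
    using Suc incseq_SucD[OF incseq_scalar_iter, of n] norm_triangle_ineq[of U V]
      norm_sqrt_iter_le[OF C, of n] norm_sqrt_iter_le[OF C, of "Suc n"]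
    unfolding U_def[symmetric] V_def[symmetric] u_def[symmetric] v_def[symmetric]
    by (intro mult_mono) auto
  also have "(u - v) * (u + v) / 2 = scalar_iter (Suc (Suc n)) - scalar_iter (Suc n)"
    by (simp add: u_def v_def power2_eq_square field_simps)
  finally show ?case by simp
qed (use C in simp)

lemma convergent_sqrt_iter:
  fixes C :: "'a::banach \<Rightarrow>\<^sub>L 'a"
  assumes C: "norm C \<le> 1"
  shows "convergent (sqrt_iter C)"
proof -
  obtain l where "scalar_iter \<longlonglongrightarrow> l"
    using incseq_convergent[OF incseq_scalar_iter, of 1] scalar_iter_bounds by blast
  then have "summable (\<lambda>n. scalar_iter (Suc n) - scalar_iter n)"
    by (rule telescope_summable)
  then have "summable (\<lambda>n. sqrt_iter C (Suc n) - sqrt_iter C n)"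
    by (rule summable_comparison_test'[where N=0]) (rule norm_sqrt_iter_diff_le[OF C])
  from summable_LIMSEQ[OF this]
  have "sqrt_iter C \<longlonglongrightarrow> (\<Sum>n. sqrt_iter C (Suc n) - sqrt_iter C n)"
    unfolding sum_lessThan_telescope by simp
  then show ?thesis by (auto simp: convergent_def)
qed

lemma quadratic_fixed_point:
  fixes C :: "'a::{real_inner,banach} \<Rightarrow>\<^sub>L 'a"
  assumes C: "norm C \<le> 1" and sym: "\<And>x y. inner (C x) y = inner x (C y)"
  shows "\<exists>Y. norm Y \<le> 1 \<and> C + (Y o\<^sub>L Y) = 2 *\<^sub>R Y \<and>
    (\<forall>x y. inner (Y x) y = inner x (Y y)) \<and> (\<forall>X. X o\<^sub>L C = C o\<^sub>L X \<longrightarrow> X o\<^sub>L Y = Y o\<^sub>L X)"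
proof -
  obtain Y where Y: "sqrt_iter C \<longlonglongrightarrow> Y"
    using convergent_sqrt_iter[OF C] by (auto simp: convergent_def)
  note compose = bounded_bilinear.tendsto[OF bounded_bilinear_blinfun_compose]
  have "norm Y \<le> 1"
    using norm_sqrt_iter_le[OF C] scalar_iter_bounds
    by (intro LIMSEQ_le_const2[OF tendsto_norm[OF Y]]) (meson order_trans)
  moreover have "C + (Y o\<^sub>L Y) = 2 *\<^sub>R Y"
  proof -
    have "(\<lambda>n. 2 *\<^sub>R sqrt_iter C (Suc n)) \<longlonglongrightarrow> 2 *\<^sub>R Y"
      by (intro tendsto_intros LIMSEQ_Suc Y)
    moreover have "(\<lambda>n. C + (sqrt_iter C n o\<^sub>L sqrt_iter C n)) \<longlonglongrightarrow> C + (Y o\<^sub>L Y)"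
      by (intro tendsto_intros compose Y)
    ultimately show ?thesis using LIMSEQ_unique by fastforce
  qed
  moreover have "inner (Y x) y = inner x (Y y)" for x y
  proof -
    have iter: "inner (sqrt_iter C n x) y = inner x (sqrt_iter C n y)" for n x y
      by (induction n arbitrary: x y)
        (simp_all add: blinfun.add_left blinfun.scaleR_left inner_add_left inner_add_right sym)
    have "(\<lambda>n. inner (sqrt_iter C n x) y) \<longlonglongrightarrow> inner (Y x) y"
      "(\<lambda>n. inner x (sqrt_iter C n y)) \<longlonglongrightarrow> inner x (Y y)"
      by (intro tendsto_intros Y)+
    then show ?thesis unfolding iter by (rule LIMSEQ_unique)
  qed
  moreover have "X o\<^sub>L Y = Y o\<^sub>L X" if "X o\<^sub>L C = C o\<^sub>L X" for X
  proof (rule LIMSEQ_unique)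
    show "(\<lambda>n. X o\<^sub>L sqrt_iter C n) \<longlonglongrightarrow> (X o\<^sub>L Y)" by (intro compose tendsto_const Y)
    show "(\<lambda>n. X o\<^sub>L sqrt_iter C n) \<longlonglongrightarrow> (Y o\<^sub>L X)"
      unfolding sqrt_iter_commute[OF that] by (intro compose tendsto_const Y)
  qed
  ultimately show ?thesis by blast
qed

text \<open>
  After rescaling, \<open>0 \<le> B \<le> 1\<close>, and \<open>C = 1 - B\<close> is a contraction by the Cauchy--Schwarz inequality
  for its own form.
\<close>

lemma positive_sqrt_exists:
  fixes B :: "'h::chilbert_space \<Rightarrow> 'h"
  assumes B: "bounded_op B" "positive_op B"
  shows "\<exists>R. bounded_op R \<and> positive_op R \<and> R \<circ> R = B \<and>
    (\<forall>X. bounded_linear X \<longrightarrow> (\<forall>x. X (B x) = B (X x)) \<longrightarrow> (\<forall>x. X (R x) = R (X x)))"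
proof -
  note B_lin = linear_simps[OF bounded_op_linear[OF B(1)]]
  have sym: "inner (B x) y = inner x (B y)" and pos: "0 \<le> inner (B x) x" for x y
    using B by (auto simp: positive_op_iff)
  obtain M where M: "M > 0" "\<And>x. norm (B x) \<le> norm x * M"
    using bounded_linear.pos_bounded[OF bounded_op_linear[OF B(1)]] by blast
  define c where "c x = x - (1 / M) *\<^sub>R B x" for x
  have c_bl: "bounded_linear c"
    unfolding c_def
    by (intro bounded_linear_sub bounded_linear_ident bounded_linear_scaleR_right
        bounded_linear_compose[OF bounded_linear_scaleR_right] bounded_op_linear B)
  have c_sym: "inner (c x) y = inner x (c y)" for x y
    by (simp add: c_def inner_diff_left inner_diff_right sym)
  have c_pos: "0 \<le> inner (c x) x" and c_le: "inner (c x) x \<le> (norm x)\<^sup>2" for x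
  proof -
    have "inner (B x) x \<le> norm (B x) * norm x" by (rule norm_cauchy_schwarz)
    also have "\<dots> \<le> norm x * M * norm x" by (intro mult_right_mono M) auto
    finally have "inner (B x) x / M \<le> (norm x)\<^sup>2"
      using M(1) by (simp add: power2_eq_square field_simps)
    then show "0 \<le> inner (c x) x" "inner (c x) x \<le> (norm x)\<^sup>2"
      using pos[of x] M(1) by (simp_all add: c_def inner_diff_left power2_norm_eq_inner)
  qed
  have c_norm: "norm (c x) \<le> norm x" for x
  proof (cases "c x = 0")
    case False
    have "(inner (c x) (c x))\<^sup>2 \<le> inner (c x) x * inner (c (c x)) (c x)"
      by (rule positive_Cauchy_Schwarz[OF bounded_linear.linear[OF c_bl] c_sym c_pos])
    also have "\<dots> \<le> (norm x)\<^sup>2 * (norm (c x))\<^sup>2"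
      by (intro mult_mono c_le c_pos) auto
    finally have "(norm (c x))\<^sup>2 * (norm (c x))\<^sup>2 \<le> (norm x)\<^sup>2 * (norm (c x))\<^sup>2"
      unfolding power2_norm_eq_inner by (simp add: power2_eq_square)
    then have "(norm (c x))\<^sup>2 \<le> (norm x)\<^sup>2"
      by (rule mult_right_le_imp_le) (use False in simp)
    then show ?thesis by (rule power2_le_imp_le) simp
  qed simp
  define C where "C = Blinfun c"
  have C_apply: "blinfun_apply C = c" unfolding C_def by (rule bounded_linear_Blinfun_apply[OF c_bl])
  have "norm C \<le> 1" by (rule norm_blinfun_bound) (simp_all add: C_apply c_norm)
  have C_sym: "inner (C x) y = inner x (C y)" for x y by (simp add: C_apply c_sym)
  obtain Y where Y: "norm Y \<le> 1 \<and> C + (Y o\<^sub>L Y) = 2 *\<^sub>R Y \<and>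
    (\<forall>x y. inner (Y x) y = inner x (Y y)) \<and> (\<forall>X. X o\<^sub>L C = C o\<^sub>L X \<longrightarrow> X o\<^sub>L Y = Y o\<^sub>L X)"
    using quadratic_fixed_point[OF \<open>norm C \<le> 1\<close> C_sym] ..
  then have Y_norm: "norm Y \<le> 1" and Y_eq: "C + (Y o\<^sub>L Y) = 2 *\<^sub>R Y"
    and Y_sym: "inner (Y x) y = inner x (Y y)"
    and Y_commute: "X o\<^sub>L C = C o\<^sub>L X \<Longrightarrow> X o\<^sub>L Y = Y o\<^sub>L X" for x y X
    by blast+
  define R where "R x = sqrt M *\<^sub>R (x - Y x)" for x
  have commute: "X (R x) = R (X x)" if X: "bounded_linear X" "\<And>x. X (B x) = B (X x)" for X x
  proof -
    note X_lin = linear_simps[OF X(1)]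
    have XB: "blinfun_apply (Blinfun X) = X" by (rule bounded_linear_Blinfun_apply[OF X(1)])
    have "Blinfun X o\<^sub>L C = C o\<^sub>L Blinfun X"
      by (rule blinfun_eqI) (simp add: C_apply XB c_def X X_lin)
    then have "Blinfun X o\<^sub>L Y = Y o\<^sub>L Blinfun X" by (rule Y_commute)
    then have "(Blinfun X o\<^sub>L Y) x = (Y o\<^sub>L Blinfun X) x" by simp
    then have "X (Y x) = Y (X x)" by (simp add: XB)
    then show ?thesis by (simp add: R_def X_lin)
  qed
  \<comment> \<open>Multiplication by a complex scalar is a real-linear operator that commutes with \<open>B\<close>.\<close>
  have "bounded_op R"
    unfolding bounded_op_iff
  proof (intro conjI allI)
    show "bounded_linear R"
      unfolding R_def by (intro bounded_linear_compose[OF bounded_linear_scaleR_right]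
          bounded_linear_sub bounded_linear_ident blinfun.bounded_linear_right)
    fix z and x :: 'h
    show "R (z *\<^sub>C x) = z *\<^sub>C R x"
      using commute[OF bounded_linear_scaleC, of z x] bounded_op_scaleC[OF B(1)] by simp
  qed
  moreover have "positive_op R"
    unfolding positive_op_iff[OF \<open>bounded_op R\<close>]
  proof (intro conjI allI)
    fix x y
    show "inner (R x) y = inner x (R y)"
      by (simp add: R_def Y_sym inner_diff_left inner_diff_right)
    have "inner (Y x) x \<le> norm (Y x) * norm x" by (rule norm_cauchy_schwarz)
    also have "\<dots> \<le> (norm Y * norm x) * norm x" by (intro mult_right_mono norm_blinfun) auto
    also have "\<dots> \<le> (1 * norm x) * norm x" by (intro mult_right_mono Y_norm) auto
    finally show "0 \<le> inner (R x) x"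
      using M(1) by (simp add: R_def inner_diff_left power2_eq_square flip: power2_norm_eq_inner)
  qed
  moreover have "R \<circ> R = B"
  proof
    fix x
    have "(C + (Y o\<^sub>L Y)) x = (2 *\<^sub>R Y) x" using Y_eq by simp
    then have "c x + Y (Y x) = 2 *\<^sub>R Y x" by (simp add: C_apply blinfun.add_left blinfun.scaleR_left)
    then have "x - Y x - (Y x - Y (Y x)) = (1 / M) *\<^sub>R B x"
      by (simp add: c_def scaleR_2 algebra_simps)
    then show "(R \<circ> R) x = B x"
      using M(1) by (simp add: R_def blinfun.diff_right blinfun.scaleR_right
          flip: scaleR_diff_right)
  qed
  ultimately show ?thesis using commute by blast
qed

text \<open>
  For commuting roots \<open>(R + R') (R - R') = 0\<close>. On a vector \<open>y = (R - R') x\<close> the two nonnegative forms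
  add up to zero, so \<open>R y = R' y = 0\<close>, and then \<open>inner y y = inner x ((R - R') y) = 0\<close>.
\<close>

lemma positive_sqrt_unique:
  fixes R R' :: "'h::chilbert_space \<Rightarrow> 'h"
  assumes R: "bounded_op R" "positive_op R" and R': "bounded_op R'" "positive_op R'"
    and sq: "R \<circ> R = R' \<circ> R'" and commute: "\<And>x. R (R' x) = R' (R x)"
  shows "R = R'"
proof
  fix x
  note R_lin = linear_simps[OF bounded_op_linear[OF R(1)]]
  note R'_lin = linear_simps[OF bounded_op_linear[OF R'(1)]]
  have sym: "inner (R x) y = inner x (R y)" "inner (R' x) y = inner x (R' y)"
    and pos: "0 \<le> inner (R x) x" "0 \<le> inner (R' x) x" for x y
    using R R' by (auto simp: positive_op_iff)
  have sqx: "R (R z) = R' (R' z)" for z using fun_cong[OF sq, of z] by simp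
  define y where "y = R x - R' x"
  have "R y + R' y = 0" by (simp add: y_def R_lin R'_lin commute sqx)
  then have "inner (R y) y + inner (R' y) y = 0" by (simp flip: inner_add_left)
  then have zero: "inner (R y) y = 0" "inner (R' y) y = 0" using pos[of y] by linarith+
  have ker: "R y = 0" "R' y = 0"
  proof -
    have "(inner (R y) (R y))\<^sup>2 \<le> 0"
      using positive_Cauchy_Schwarz[OF bounded_linear.linear[OF bounded_op_linear[OF R(1)]] sym(1) pos(1),
          of y "R y"] zero by simp
    then show "R y = 0" by simp
    have "(inner (R' y) (R' y))\<^sup>2 \<le> 0"
      using positive_Cauchy_Schwarz[OF bounded_linear.linear[OF bounded_op_linear[OF R'(1)]] sym(2) pos(2),
          of y "R' y"] zero by simp
    then show "R' y = 0" by simp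
  qed
  have "inner y y = inner x (R y) - inner x (R' y)"
    by (simp add: sym(1)[symmetric] sym(2)[symmetric] flip: inner_diff_left y_def)
  then have "inner y y = 0" by (simp add: ker)
  then show "R x = R' x" by (simp add: y_def)
qed

lemma op_sqrt_props:
  fixes B :: "'h::chilbert_space \<Rightarrow> 'h"
  assumes B: "bounded_op B" "positive_op B"
  shows bounded_op_sqrt: "bounded_op (op_sqrt B)"
    and positive_op_sqrt: "positive_op (op_sqrt B)"
    and op_sqrt_sqrt: "op_sqrt B (op_sqrt B x) = B x"
proof -
  obtain R where "bounded_op R \<and> positive_op R \<and> R \<circ> R = B \<and>
    (\<forall>X. bounded_linear X \<longrightarrow> (\<forall>x. X (B x) = B (X x)) \<longrightarrow> (\<forall>x. X (R x) = R (X x)))"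
    using positive_sqrt_exists[OF B] ..
  then have R: "bounded_op R" "positive_op R" "R \<circ> R = B"
    and commute: "bounded_linear X \<Longrightarrow> \<forall>x. X (B x) = B (X x) \<Longrightarrow> X (R x) = R (X x)" for X x
    by blast+
  have "op_sqrt B = R"
    unfolding op_sqrt_def
  proof (rule the_equality)
    fix R' assume R': "bounded_op R' \<and> positive_op R' \<and> R' \<circ> R' = B"
    then have "R' (R' x) = B x" for x by (auto simp: o_def fun_eq_iff)
    then have R'B: "\<forall>x. R' (B x) = B (R' x)" by metis
    have "bounded_linear R'" using R' bounded_op_linear by blast
    show "R' = R"
    proof (rule positive_sqrt_unique)
      show "R' (R x) = R (R' x)" for x by (rule commute) fact+
      show "R' \<circ> R' = R \<circ> R" using R' R(3) by (elim conjE) (rule trans, assumption, rule sym)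
    qed (use R R' in blast)+
  qed (use R in blast)
  then show "bounded_op (op_sqrt B)" "positive_op (op_sqrt B)" "op_sqrt B (op_sqrt B x) = B x"
    using R(1,2) fun_cong[OF R(3)] by simp_all
qed

lemma norm_op_sqrt:
  fixes B :: "'h::chilbert_space \<Rightarrow> 'h"
  assumes B: "bounded_op B" "positive_op B"
  shows "(norm (op_sqrt B x))\<^sup>2 = inner (B x) x"
  using positive_op_sqrt[OF B] op_sqrt_sqrt[OF B]
  by (simp add: positive_op_iff[OF bounded_op_sqrt[OF B]] power2_norm_eq_inner inner_commute)

lemma range_op_sqrt_subset_iff:
  fixes B C :: "'h::chilbert_space \<Rightarrow> 'h"
  assumes B: "bounded_op B" "positive_op B" and C: "bounded_op C" "positive_op C"
  shows "range (op_sqrt B) \<subseteq> range (op_sqrt C)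
    \<longleftrightarrow> (\<exists>c>0. \<forall>x. norm (op_sqrt B x) \<le> c * norm (op_sqrt C x))"
proof -
  have lin: "linear (op_sqrt B)" "linear (op_sqrt C)"
    using bounded_op_sqrt[OF B] bounded_op_sqrt[OF C]
    by (auto intro: bounded_linear.linear bounded_op_linear)
  have sym: "inner (op_sqrt B x) y = inner x (op_sqrt B y)"
    "inner (op_sqrt C x) y = inner x (op_sqrt C y)" for x y
    using positive_op_sqrt[OF B] positive_op_sqrt[OF C] bounded_op_sqrt[OF B] bounded_op_sqrt[OF C]
    by (auto simp: positive_op_iff)
  show ?thesis
    using norm_le_if_range_subset[OF lin(1) sym(1) lin(2) sym(2)]
      range_subset_if_norm_le[OF lin(1) sym(1) lin(2) sym(2)] by (meson less_imp_le)
qed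


section \<open>From a lifting to an operator\<close>

text \<open>
  For a lifting \<open>S\<close> as in the theorem the restriction of \<open>S\<^sup>* S\<close> to \<open>\<H>\<close> is such an \<open>A\<close>. The name refers
  to the form \<open>inner (S\<^sup>* S x) y\<close>, a weighted inner product for which a quasi-isometry is an isometry.
\<close>

definition lifting_weight :: "('h::chilbert_space \<Rightarrow> 'h) \<Rightarrow> ('h \<Rightarrow> 'h) \<Rightarrow> bool" where
  "lifting_weight T A \<longleftrightarrow>
     invertible_op A \<and> A \<ge>\<^sub>o\<^sub>p adj T \<circ> T \<and> A \<ge>\<^sub>o\<^sub>p adj T \<circ> A \<circ> T \<and>
     range (op_sqrt (\<lambda>h. A h - (adj T \<circ> T) h)) =
     range (op_sqrt (\<lambda>h. A h - (adj T \<circ> A \<circ> T) h))"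

lemma bounded_op_defects:
  fixes T A :: "'h::chilbert_space \<Rightarrow> 'h"
  assumes T: "bounded_op T" and A: "bounded_op A"
  shows "bounded_op (\<lambda>h. A h - (adj T \<circ> T) h)" "bounded_op (\<lambda>h. A h - (adj T \<circ> A \<circ> T) h)"
  by (intro bounded_op_diff bounded_op_compose bounded_op_adj T A)+

lemma inner_defects:
  fixes T A :: "'h::chilbert_space \<Rightarrow> 'h"
  assumes T: "bounded_op T"
  shows "inner (A h - (adj T \<circ> T) h) g = inner (A h) g - inner (T h) (T g)"
  "inner (A h - (adj T \<circ> A \<circ> T) h) g = inner (A h) g - inner (A (T h)) (T g)"
  by (simp_all add: inner_diff_left inner_diff_right inner_commute[of _ g] inner_commute[of _ "T g"] inner_adj[OF T])

lemma proj_onto_eqI: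
  assumes J: "hilbert_extension K J" and orth: "\<And>g. inner (J g) (k - J h) = 0"
  shows "proj_onto J k = h"
  unfolding proj_onto_def
proof (rule the_equality)
  have J_lin: "J (x + y) = J x + J y" "J (c *\<^sub>C x) = c *\<^sub>C J x" "cinner (J x) (J y) = cinner x y" for x y c
    using J by (auto simp: hilbert_extension_def)
  have "\<forall>g\<in>UNIV. cinner (J g) (k - J h) = cinner 0 0"
    by (subst cinner_eq_all_iff) (simp_all add: J_lin scaleC_zero cinner_zero orth)
  then show "\<forall>g. cinner (k - J h) (J g) = 0"
    by (subst cinner_commute) (simp add: cinner_zero)
  fix f assume "\<forall>g. cinner (k - J f) (J g) = 0"
  then have f: "inner (k - J f) (J g) = 0" for g by (simp add: inner_eq_Re_cinner)
  have "inner (J f - J h) (J g) = 0" for g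
    using f[of g] orth[of g] by (simp add: inner_diff_left inner_diff_right inner_commute)
  moreover have "J f - J h = J (f - h)"
    using J_lin(1)[of "f - h" h] by simp
  ultimately have "inner (J (f - h)) (J (f - h)) = 0" by metis
  then have "inner (f - h) (f - h) = 0" by (simp add: inner_eq_Re_cinner J_lin)
  then show "f = h" by simp
qed

lemma inner_proj_onto:
  fixes J :: "'h::chilbert_space \<Rightarrow> 'a::complex_inner"
  assumes J: "hilbert_extension K J"
  shows "inner (J g) k = inner g (proj_onto J k)"
proof -
  have J_add: "J (x + y) = J x + J y" and J_scaleC: "J (c *\<^sub>C x) = c *\<^sub>C J x"
    and J_cinner: "cinner (J x) (J y) = cinner x y" for x y c
    using J by (auto simp: hilbert_extension_def)
  have J_inner: "inner (J x) (J y) = inner x y" for x y by (simp add: inner_eq_Re_cinner J_cinner)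
  then have J_norm: "norm (J x) = norm x" for x by (simp add: norm_eq_sqrt_inner)
  have "\<exists>h\<in>closure ((\<lambda>x. x) ` UNIV). norm h \<le> norm k \<and> (\<forall>g\<in>UNIV. inner (J g) k = inner g h)"
  proof (rule functional_representation)
    fix x show "\<bar>inner (J x) k\<bar> \<le> norm k * norm x"
      using Cauchy_Schwarz_ineq2[of "J x" k] by (simp add: J_norm mult.commute)
    show "inner (J (r *\<^sub>R x)) k = r * inner (J x) k" for r
      using J_scaleC[of "complex_of_real r" x] by (simp flip: scaleR_scaleC)
  qed (auto simp: J_add inner_add_left)
  then obtain h where h: "\<And>g. inner (J g) k = inner g h" by blast
  then have "proj_onto J k = h"
    by (intro proj_onto_eqI[OF J]) (simp add: inner_diff_right J_inner)
  then show ?thesis using h by simp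
qed

text \<open>
  The operator \<open>A\<close> is the restriction of \<open>S\<^sup>* S\<close> to the reducing subspace \<open>\<H>\<close>. The lifting property
  splits \<open>S (J h)\<close> orthogonally into \<open>J (T h)\<close> and \<open>X h\<close>, so that
  \<open>inner ((A - T\<^sup>* T) h) h = (norm (X h))\<^sup>2\<close>. A second application of \<open>S\<close> preserves the norm, and it
  keeps the two parts orthogonal since \<open>S\<^sup>* S\<close> maps \<open>J (T h)\<close> into the range of \<open>J\<close>; this gives
  \<open>inner ((A - T\<^sup>* A T) h) h = (norm (S (X h)))\<^sup>2\<close>. As \<open>S\<close> is bounded above and below, the two
  quantities are comparable, and the square roots have the same range.
\<close>

lemma lifting_weight_if_lifting:
  fixes T :: "'h::chilbert_space \<Rightarrow> 'h" and K :: "'k::chilbert_space set"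
  assumes T: "bounded_op T" and L: "lifting K J S T"
    and inv: "left_invertible_on K S" and quasi: "quasi_isometry_on K S"
    and reduce: "(adj_on K S \<circ> S) ` range J \<subseteq> range J"
  shows "\<exists>A. lifting_weight T A"
proof -
  have J: "hilbert_extension K J" and S: "bounded_op_on K S"
    and PS: "\<And>k. k \<in> K \<Longrightarrow> proj_onto J (S k) = T (proj_onto J k)"
    using L by (auto simp: lifting_def)
  have K: "csubspace K" "closed K" and JK: "J x \<in> K"
    and J_add: "J (x + y) = J x + J y" and J_scaleC: "J (c *\<^sub>C x) = c *\<^sub>C J x"
    and J_cinner: "cinner (J x) (J y) = cinner x y" for x y c
    using J by (auto simp: hilbert_extension_def)
  have J_inner: "inner (J x) (J y) = inner x y" for x y by (simp add: inner_eq_Re_cinner J_cinner)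
  then have J_norm: "norm (J x) = norm x" for x by (simp add: norm_eq_sqrt_inner)
  have J_inj: "x = y" if "J x = J y" for x y
  proof -
    have "J (x - y) + J y = J y" using J_add[of "x - y" y] that by simp
    then show ?thesis using J_norm[of "x - y"] by simp
  qed
  have SK: "S x \<in> K" and S_add: "S (x + y) = S x + S y" and S_scaleC: "S (c *\<^sub>C x) = c *\<^sub>C S x"
    if "x \<in> K" "y \<in> K" for x y c
    using S that by (auto simp: bounded_op_on_def)
  obtain B0 where B0: "\<And>x. x \<in> K \<Longrightarrow> norm (S x) \<le> B0 * norm x"
    using S unfolding bounded_op_on_def by blast
  define B where "B = \<bar>B0\<bar>"
  have B: "norm (S x) \<le> B * norm x" "B \<ge> 0" if "x \<in> K" for x
  proof -
    have "B0 * norm x \<le> B * norm x" by (intro mult_right_mono) (auto simp: B_def)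
    then show "norm (S x) \<le> B * norm x" using B0[OF that] by linarith
  qed (simp add: B_def)
  obtain c where c: "c > 0" "\<And>x. x \<in> K \<Longrightarrow> c * norm x \<le> norm (S x)"
    using left_invertible_on_bounded_below[OF K S inv] by blast

  have "\<forall>h. \<exists>a. adj_on K S (S (J h)) = J a" using reduce by (auto simp: image_subset_iff)
  from choice[OF this] obtain A where A: "\<And>h. adj_on K S (S (J h)) = J (A h)" by blast
  have SA: "inner (S x) (S (J h)) = inner x (J (A h))" if "x \<in> K" for x h
    using inner_adj_on[OF K S that] by (simp add: A)
  have A_form: "inner (A h) g = inner (S (J h)) (S (J g))" for h g
    using SA[OF JK, of g h] by (simp add: J_inner inner_commute)
  have A_bounded: "bounded_op A"
    unfolding bounded_op_on_def
  proof (intro conjI ballI allI exI)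
    fix x y :: 'h and r
    show "A (x + y) = A x + A y"
      by (rule J_inj) (simp add: J_add S_add JK adj_on_linear[OF K S] flip: A)
    show "A (r *\<^sub>C x) = r *\<^sub>C A x"
      by (rule J_inj) (simp add: J_scaleC S_scaleC[OF JK JK] adj_on_linear[OF K S] flip: A)
    have "norm (A x) * norm (A x) = inner (S (J x)) (S (J (A x)))"
      by (simp add: A_form[symmetric] flip: power2_norm_eq_inner power2_eq_square)
    also have "\<dots> \<le> norm (S (J x)) * norm (S (J (A x)))" by (rule norm_cauchy_schwarz)
    also have "\<dots> \<le> (B * norm (J x)) * (B * norm (J (A x)))"
      by (intro mult_mono B JK mult_nonneg_nonneg B(2)[OF JK]) auto
    finally have "norm (A x) * norm (A x) \<le> norm (A x) * (B * B * norm x)"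
      by (simp add: J_norm mult_ac)
    then show "norm (A x) \<le> (B * B) * norm x" by (cases "A x = 0") auto
  qed auto
  have A_sym: "inner (A x) y = inner x (A y)" for x y
    by (metis A_form inner_commute)
  have "invertible_op A"
  proof (rule invertible_op_if_coercive[OF A_bounded A_sym])
    show "c\<^sup>2 > 0" using c(1) by simp
    show "c\<^sup>2 * (norm h)\<^sup>2 \<le> inner (A h) h" for h
    proof -
      have "(c * norm (J h))\<^sup>2 \<le> (norm (S (J h)))\<^sup>2"
        using c(1) by (intro power_mono c JK) auto
      then show ?thesis by (simp add: A_form J_norm power_mult_distrib flip: power2_norm_eq_inner)
    qed
  qed

  define X where "X h = S (J h) - J (T h)" for h
  have XK: "X h \<in> K" for h
    unfolding X_def using SK[OF JK JK] JK by (intro subspace_diff[OF csubspace_imp_subspace[OF K(1)]])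
  have SJ: "S (J h) = J (T h) + X h" for h by (simp add: X_def)
  have X_orth: "inner (J g) (X h) = 0" for g h
  proof -
    have "proj_onto J (J h) = h" by (rule proj_onto_eqI[OF J]) simp
    then have "inner (J g) (S (J h)) = inner g (T h)"
      using PS[OF JK, of h] by (simp add: inner_proj_onto[OF J])
    then show ?thesis by (simp add: X_def inner_diff_right J_inner)
  qed
  have norm_X: "inner (A h) h - inner (T h) (T h) = (norm (X h))\<^sup>2" for h
  proof -
    have "inner (A h) h = inner (J (T h) + X h) (J (T h) + X h)" by (simp add: A_form SJ)
    also have "\<dots> = inner (T h) (T h) + inner (X h) (X h)"
      by (simp add: inner_add_left inner_add_right X_orth J_inner inner_commute[of "X h" "J (T h)"])
    finally show ?thesis by (simp add: power2_norm_eq_inner)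
  qed
  have isometric: "inner (S (S x)) (S (S x)) = inner (S x) (S x)" if "x \<in> K" for x
    using quasi that SK[OF that that] inner_adj_on[OF K S]
    by (simp add: quasi_isometry_on_def)
  have norm_SX: "inner (A h) h - inner (A (T h)) (T h) = (norm (S (X h)))\<^sup>2" for h
  proof -
    have "inner (A h) h = inner (S (J (T h)) + S (X h)) (S (J (T h)) + S (X h))"
      using isometric[OF JK, of h] by (simp add: A_form SJ[of h] S_add JK XK)
    moreover have "inner (S (X h)) (S (J (T h))) = 0"
      by (simp add: SA[OF XK] X_orth inner_commute[of "X h"])
    ultimately show ?thesis
      by (simp add: inner_add_left inner_add_right A_form power2_norm_eq_inner
          inner_commute[of "S (J (T h))" "S (X h)"])
  qed

  let ?D = "\<lambda>h. A h - (adj T \<circ> T) h" and ?E = "\<lambda>h. A h - (adj T \<circ> A \<circ> T) h"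
  note bounded = bounded_op_defects[OF T A_bounded]
    and form = inner_defects[OF T]
  have D: "positive_op ?D"
    unfolding positive_op_iff[OF bounded(1)]
    using form(1) norm_X A_sym by (metis inner_commute zero_le_power2)
  have E: "positive_op ?E"
    unfolding positive_op_iff[OF bounded(2)]
    using form(2) norm_SX A_sym by (metis inner_commute zero_le_power2)
  have norm_D: "norm (op_sqrt ?D h) = norm (X h)" for h
    using norm_op_sqrt[OF bounded(1) D, of h] unfolding form norm_X
    by (rule power2_eq_imp_eq) simp_all
  have norm_E: "norm (op_sqrt ?E h) = norm (S (X h))" for h
    using norm_op_sqrt[OF bounded(2) E, of h] unfolding form norm_SX
    by (rule power2_eq_imp_eq) simp_all
  have "range (op_sqrt ?D) \<subseteq> range (op_sqrt ?E)"
    unfolding range_op_sqrt_subset_iff[OF bounded(1) D bounded(2) E] norm_D norm_E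
    using c(1) c(2)[OF XK] by (intro exI[of _ "1 / c"]) (auto simp: field_simps)
  moreover have "range (op_sqrt ?E) \<subseteq> range (op_sqrt ?D)"
    unfolding range_op_sqrt_subset_iff[OF bounded(2) E bounded(1) D] norm_D norm_E
  proof (intro exI conjI allI)
    show "norm (S (X h)) \<le> (B + 1) * norm (X h)" for h
      using B(1)[OF XK, of h] norm_ge_zero[of "X h"] unfolding distrib_right by linarith
    show "0 < B + 1" using B(2)[OF JK] by linarith
  qed
  ultimately have "lifting_weight T A"
    using D E \<open>invertible_op A\<close> by (auto simp: lifting_weight_def op_ge_def)
  then show ?thesis by blast
qed


section \<open>Square-summable sequences\<close>

definition ell2_unit :: "nat \<Rightarrow> 'a::complex_inner \<Rightarrow> 'a ell2" where
  "ell2_unit k d = Abs_ell2 (\<lambda>n. if n = k then d else 0)"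

lemma ell2_nth_unit [simp]: "ell2_nth (ell2_unit k d) n = (if n = k then d else 0)"
proof -
  have "(\<lambda>n. (norm (if n = k then d else 0))\<^sup>2) = (\<lambda>n. if n = k then (norm d)\<^sup>2 else 0)"
    by auto
  then have "square_summable (\<lambda>n. if n = k then d else 0)"
    using summable_single[of k "\<lambda>_. (norm d)\<^sup>2"] by (simp add: square_summable_def)
  then show ?thesis by (simp add: ell2_unit_def ell2_nth_Abs)
qed

lemma cinner_ell2_unit: "cinner (ell2_unit k d) x = cinner d (ell2_nth x k)"
proof -
  have "(\<lambda>n. cinner (ell2_nth (ell2_unit k d) n) (ell2_nth x n))
      = (\<lambda>n. if n = k then cinner d (ell2_nth x n) else 0)"
    by (auto simp: cinner_zero)
  then show ?thesis
    using sums_unique[OF sums_single[of k "\<lambda>n. cinner d (ell2_nth x n)"]]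
    by (simp add: cinner_ell2_def)
qed

lemma inner_ell2_unit: "inner (ell2_unit k d) x = inner d (ell2_nth x k)"
  by (simp add: inner_eq_Re_cinner cinner_ell2_unit)

lemma norm_ell2_unit: "norm (ell2_unit k d) = norm d"
  by (simp add: norm_eq_sqrt_inner inner_ell2_unit)

lemma ell2_unit_linear:
  "ell2_unit k (x + y) = ell2_unit k x + ell2_unit k y"
  "ell2_unit k (r *\<^sub>R x) = r *\<^sub>R ell2_unit k x"
  "ell2_unit k (c *\<^sub>C x) = c *\<^sub>C ell2_unit k x"
  by (auto intro!: ell2_eqI simp: scaleC_zero)

lemma bounded_linear_ell2_unit: "bounded_linear (ell2_unit k)"
  by (rule bounded_linear_intro[where K=1]) (auto simp: ell2_unit_linear norm_ell2_unit)

lemma bounded_linear_ell2_nth: "bounded_linear (\<lambda>x::'a::complex_inner ell2. ell2_nth x n)"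
  by (rule bounded_linear_intro[where K=1]) (auto simp: norm_ell2_nth_le)

lemma ell2_unit_expansion:
  fixes x :: "'a::complex_inner ell2"
  shows "(\<lambda>N. \<Sum>k<N. ell2_unit k (ell2_nth x k)) \<longlonglongrightarrow> x"
proof -
  define s where "s N = (\<Sum>k<N. ell2_unit k (ell2_nth x k))" for N
  have nth: "ell2_nth (s N) n = (if n < N then ell2_nth x n else 0)" for N n
    by (induction N) (auto simp: s_def less_Suc_eq)
  have summable: "summable (\<lambda>n. (norm (ell2_nth y n))\<^sup>2)" for y :: "'a ell2"
    using square_summable_ell2_nth[of y] by (simp add: square_summable_def)
  have "(norm (s N - x))\<^sup>2 = (\<Sum>n. (norm (ell2_nth x (n + N)))\<^sup>2)" for N
    unfolding norm_ell2_power2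
    by (subst suminf_split_initial_segment[OF summable, of _ N]) (simp add: nth)
  moreover have "(\<lambda>N. \<Sum>n. (norm (ell2_nth x (n + N)))\<^sup>2) \<longlonglongrightarrow> 0"
    by (rule suminf_exist_split2[OF summable])
  ultimately have "(\<lambda>N. sqrt ((norm (s N - x))\<^sup>2)) \<longlonglongrightarrow> sqrt 0"
    by (intro tendsto_real_sqrt) simp
  then have "(\<lambda>N. norm (s N - x)) \<longlonglongrightarrow> 0" by simp
  then have "s \<longlonglongrightarrow> x" by (rule LIM_zero_cancel[OF tendsto_norm_zero_cancel])
  then show ?thesis by (simp add: s_def[abs_def])
qed

text \<open>
  The lifting acts in a special way on the first two coordinates only; \<open>tail_inner\<close> collects the
  contribution of all others to the inner product.
\<close>

definition tail_inner :: "'a::complex_inner ell2 \<Rightarrow> 'a ell2 \<Rightarrow> real" where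
  "tail_inner x y = (\<Sum>n. inner (ell2_nth x (Suc (Suc n))) (ell2_nth y (Suc (Suc n))))"

lemma inner_ell2_split:
  "inner x y = inner (ell2_nth x 0) (ell2_nth y 0) + inner (ell2_nth x 1) (ell2_nth y 1)
    + tail_inner x y"
  unfolding inner_ell2_def tail_inner_def
  by (subst suminf_split_initial_segment[OF summable_inner_ell2, of _ _ 2])
    (simp add: numeral_2_eq_2)

lemma tail_inner_nonneg: "0 \<le> tail_inner x x"
proof -
  have "summable (\<lambda>n. inner (ell2_nth x (n + 2)) (ell2_nth x (n + 2)))"
    using summable_iff_shift[where f="\<lambda>n. inner (ell2_nth x n) (ell2_nth x n)" and k=2]
      summable_inner_ell2[of x x] by blast
  then show ?thesis unfolding tail_inner_def by (intro suminf_nonneg) (simp_all add: numeral_2_eq_2)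
qed


section \<open>From an operator to a minimal lifting\<close>

text \<open>
  A unilateral shift on the coordinates from 1 on, with weight \<open>W\<close> in its first step, that is fed
  through \<open>D\<close> from coordinate 0, where \<open>T\<close> acts.
\<close>

definition lifting_seq :: "('h \<Rightarrow> 'h) \<Rightarrow> ('h \<Rightarrow> 'h) \<Rightarrow> ('h \<Rightarrow> 'h) \<Rightarrow> (nat \<Rightarrow> 'h) \<Rightarrow> nat \<Rightarrow> 'h" where
  "lifting_seq T D W f n = (case n of 0 \<Rightarrow> T (f 0) | Suc 0 \<Rightarrow> D (f 0) | Suc (Suc 0) \<Rightarrow> W (f 1)
     | Suc (Suc (Suc m)) \<Rightarrow> f (Suc (Suc m)))"

lemma lifting_seq_simps [simp]:
  "lifting_seq T D W f 0 = T (f 0)" "lifting_seq T D W f (Suc 0) = D (f 0)"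
  "lifting_seq T D W f (Suc (Suc 0)) = W (f 1)"
  "lifting_seq T D W f (Suc (Suc (Suc n))) = f (Suc (Suc n))"
  by (simp_all add: lifting_seq_def)

text \<open>
  Here \<open>D\<close> and \<open>E\<close> stand for \<open>(A - T\<^sup>* T)\<^sup>1\<^sup>/\<^sup>2\<close> and \<open>(A - T\<^sup>* A T)\<^sup>1\<^sup>/\<^sup>2\<close>, which enter through their
  forms and their common range, and \<open>W\<close>, \<open>W'\<close> for the operators that carry one to the other.
\<close>

locale lifting_model =
  fixes T A D E W W' :: "'h::chilbert_space \<Rightarrow> 'h" and a :: real
  assumes T: "bounded_op T" and A: "bounded_op A" and D: "bounded_op D" and E: "bounded_op E"
    and W: "bounded_op W" and W': "bounded_op W'"
    and a: "a > 0" "\<And>h. a * (norm h)\<^sup>2 \<le> inner (A h) h"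
    and A_D: "\<And>h g. inner (T h) (T g) + inner (D h) (D g) = inner (A h) g"
    and A_E: "\<And>h g. inner (A (T h)) (T g) + inner (E h) (E g) = inner (A h) g"
    and WD: "\<And>h. W (D h) = E h" and W'E: "\<And>h. W' (E h) = D h"
    and range_eq: "range D = range E"
begin

definition "defect = closure (range D)"

lemma csubspace_defect: "csubspace defect" and closed_defect: "closed defect"
  unfolding defect_def using csubspace_closure[OF csubspace_range[OF D]] by auto

text \<open>
  Both \<open>W\<close> and \<open>W'\<close> map the common range of \<open>D\<close> and \<open>E\<close> onto itself, and continuity passes to the
  closure. Thus \<open>W\<close> restricts to an invertible operator of the defect space, which makes the shift
  below left invertible and minimal.
\<close>

lemma W_defect: "d \<in> defect \<Longrightarrow> W d \<in> defect"
  and W'_defect: "d \<in> defect \<Longrightarrow> W' d \<in> defect"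
proof -
  have "W ` defect \<subseteq> closure (W ` range D)"
    unfolding defect_def by (intro closure_bounded_linear_image_subset bounded_op_linear W)
  also have "W ` range D = range D" by (simp add: image_image WD range_eq[symmetric])
  finally show "d \<in> defect \<Longrightarrow> W d \<in> defect" by (auto simp: defect_def)
  have "W' ` defect \<subseteq> closure (W' ` range E)"
    unfolding defect_def range_eq by (intro closure_bounded_linear_image_subset bounded_op_linear W')
  also have "W' ` range E = range D" by (simp add: image_image W'E)
  finally show "d \<in> defect \<Longrightarrow> W' d \<in> defect" by (auto simp: defect_def)
qed

lemma W_inverse:
  assumes "d \<in> defect"
  shows "W' (W d) = d" "W (W' d) = d"
proof -
  have cont: "continuous_on UNIV (\<lambda>d. W' (W d))" "continuous_on UNIV (\<lambda>d. W (W' d))"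
    using bounded_linear_compose[OF bounded_op_linear[OF W'] bounded_op_linear[OF W]]
      bounded_linear_compose[OF bounded_op_linear[OF W] bounded_op_linear[OF W']]
    by (auto intro: linear_continuous_on)
  have "closed {d. W' (W d) = d}" "closed {d. W (W' d) = d}"
    using cont by (auto intro!: closed_Collect_eq continuous_on_id)
  moreover have "range D \<subseteq> {d. W' (W d) = d}" by (auto simp: WD W'E)
  moreover have "range D \<subseteq> {d. W (W' d) = d}" unfolding range_eq by (auto simp: WD W'E)
  ultimately have "defect \<subseteq> {d. W' (W d) = d}" "defect \<subseteq> {d. W (W' d) = d}"
    unfolding defect_def by (simp_all add: closure_minimal)
  then show "W' (W d) = d" "W (W' d) = d" using assms by auto
qed

definition K :: "'h ell2 set" where "K = {x. \<forall>n. ell2_nth x (Suc n) \<in> defect}"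

definition S :: "'h ell2 \<Rightarrow> 'h ell2" where
  "S x = Abs_ell2 (lifting_seq T D W (ell2_nth x))"

lemma csubspace_K: "csubspace K"
  using csubspace_defect by (auto simp: K_def csubspace_def)

lemma closed_K: "closed K"
proof -
  have "closed {x. ell2_nth x (Suc n) \<in> defect}" for n
    using continuous_closed_vimage[OF closed_defect linear_continuous_at[OF bounded_linear_ell2_nth]]
    by (simp add: vimage_def)
  then have "closed (\<Inter>n. {x. ell2_nth x (Suc n) \<in> defect})" by (intro closed_INT) auto
  also have "(\<Inter>n. {x. ell2_nth x (Suc n) \<in> defect}) = K" by (auto simp: K_def)
  finally show ?thesis .
qed

lemma ell2_nth_S [simp]: "ell2_nth (S x) = lifting_seq T D W (ell2_nth x)"
proof -
  have "summable (\<lambda>n. (norm (ell2_nth x (n + 2)))\<^sup>2)"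
    using summable_iff_shift[where f="\<lambda>n. (norm (ell2_nth x n))\<^sup>2" and k=2]
      square_summable_ell2_nth[of x] unfolding square_summable_def by blast
  then have "summable (\<lambda>n. (norm (lifting_seq T D W (ell2_nth x) (n + 3)))\<^sup>2)"
    by (simp add: numeral_2_eq_2 numeral_3_eq_3)
  then have "summable (\<lambda>n. (norm (lifting_seq T D W (ell2_nth x) n))\<^sup>2)"
    by (rule summable_iff_shift[THEN iffD1])
  then show ?thesis by (simp add: S_def ell2_nth_Abs square_summable_def)
qed

lemma inner_S:
  "inner (S x) (S y) = inner (A (ell2_nth x 0)) (ell2_nth y 0)
    + inner (W (ell2_nth x 1)) (W (ell2_nth y 1)) + tail_inner x y"
proof -
  have "inner (S x) (S y) = (\<Sum>n. inner (ell2_nth (S x) (n + 3)) (ell2_nth (S y) (n + 3)))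
      + (\<Sum>n<3. inner (ell2_nth (S x) n) (ell2_nth (S y) n))"
    unfolding inner_ell2_def by (rule suminf_split_initial_segment[OF summable_inner_ell2])
  then show ?thesis
    by (simp add: numeral_3_eq_3 tail_inner_def flip: A_D)
qed

lemma S_linear: "S (x + y) = S x + S y" "S (c *\<^sub>C x) = c *\<^sub>C S x"
  using T D W
  by (auto intro!: ell2_eqI simp: lifting_seq_def linear_simps bounded_op_linear bounded_op_scaleC
      split: nat.split)

lemma norm_S:
  "(norm (S x))\<^sup>2 = inner (A (ell2_nth x 0)) (ell2_nth x 0) + (norm (W (ell2_nth x 1)))\<^sup>2
    + tail_inner x x"
  unfolding power2_norm_eq_inner inner_S ..

lemma norm_split:
  "(norm x)\<^sup>2 = (norm (ell2_nth x 0))\<^sup>2 + (norm (ell2_nth x 1))\<^sup>2 + tail_inner x x"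
  unfolding power2_norm_eq_inner by (rule inner_ell2_split)

lemma bounded_op_S: "bounded_op S"
proof -
  obtain b where b: "b > 0" "\<And>h. norm (A h) \<le> norm h * b"
    using bounded_linear.pos_bounded[OF bounded_op_linear[OF A]] by blast
  obtain w where w: "w > 0" "\<And>h. norm (W h) \<le> norm h * w"
    using bounded_linear.pos_bounded[OF bounded_op_linear[OF W]] by blast
  have "norm (S x) \<le> sqrt (b + w\<^sup>2 + 1) * norm x" for x
  proof -
    let ?x = "ell2_nth x"
    have "inner (A (?x 0)) (?x 0) \<le> norm (A (?x 0)) * norm (?x 0)" by (rule norm_cauchy_schwarz)
    also have "\<dots> \<le> norm (?x 0) * b * norm (?x 0)" by (intro mult_right_mono b) auto
    finally have 0: "inner (A (?x 0)) (?x 0) \<le> b * (norm (?x 0))\<^sup>2"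
      by (simp add: power2_eq_square mult_ac)
    have 1: "(norm (W (?x 1)))\<^sup>2 \<le> w\<^sup>2 * (norm (?x 1))\<^sup>2"
      using power_mono[OF w(2)[of "?x 1"], of 2] by (simp add: power_mult_distrib mult.commute)
    define p q t where "p = (norm (?x 0))\<^sup>2" and "q = (norm (?x 1))\<^sup>2" and "t = tail_inner x x"
    have "0 \<le> (b + w\<^sup>2) * t + (w\<^sup>2 + 1) * p + (b + 1) * q"
      using b(1) tail_inner_nonneg[of x] by (simp add: p_def q_def t_def)
    also have "\<dots> = (b + w\<^sup>2 + 1) * (p + q + t) - (b * p + w\<^sup>2 * q + t)"
      by (simp add: algebra_simps)
    finally have "(norm (S x))\<^sup>2 \<le> (b + w\<^sup>2 + 1) * (norm x)\<^sup>2"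
      unfolding norm_S norm_split[of x] p_def q_def t_def using 0 1 by linarith
    then have "sqrt ((norm (S x))\<^sup>2) \<le> sqrt ((b + w\<^sup>2 + 1) * (norm x)\<^sup>2)" by (rule real_sqrt_le_mono)
    then show ?thesis by (simp add: real_sqrt_mult)
  qed
  then show ?thesis using S_linear by (auto simp: bounded_op_on_def)
qed

lemma S_K: "x \<in> K \<Longrightarrow> S x \<in> K"
  using closure_subset[of "range D"]
  by (auto simp: K_def lifting_seq_def defect_def[symmetric] intro: W_defect split: nat.split)

lemma bounded_op_on_K: "bounded_op_on K S"
  using bounded_op_S S_K by (auto simp: bounded_op_on_def)

lemma S_bounded_below: "\<exists>c>0. \<forall>x\<in>K. c * norm x \<le> norm (S x)"
proof -
  obtain b where b: "b > 0" "\<And>h. norm (W' h) \<le> norm h * b"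
    using bounded_linear.pos_bounded[OF bounded_op_linear[OF W']] by blast
  define c where "c = min 1 (min a (1 / b\<^sup>2))"
  have c: "0 < c" "c \<le> 1" "c \<le> a" "c \<le> 1 / b\<^sup>2" using a b by (auto simp: c_def)
  have "sqrt c * norm x \<le> norm (S x)" if "x \<in> K" for x
  proof -
    let ?x = "ell2_nth x"
    have "?x 1 \<in> defect" using that by (auto simp: K_def)
    then have "norm (?x 1) \<le> norm (W (?x 1)) * b"
      using b(2)[of "W (?x 1)"] by (simp add: W_inverse)
    then have "(norm (?x 1))\<^sup>2 \<le> (norm (W (?x 1)) * b)\<^sup>2" by (intro power_mono) auto
    then have "1 / b\<^sup>2 * (norm (?x 1))\<^sup>2 \<le> (norm (W (?x 1)))\<^sup>2"
      using b(1) by (simp add: power_mult_distrib field_simps)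
    moreover have "c * (norm (?x 1))\<^sup>2 \<le> 1 / b\<^sup>2 * (norm (?x 1))\<^sup>2"
      "c * (norm (?x 0))\<^sup>2 \<le> a * (norm (?x 0))\<^sup>2" "c * tail_inner x x \<le> 1 * tail_inner x x"
      using c by (intro mult_right_mono tail_inner_nonneg; simp)+
    ultimately have "c * (norm x)\<^sup>2 \<le> (norm (S x))\<^sup>2"
      unfolding norm_S norm_split[of x] using a(2)[of "?x 0"] by (simp add: algebra_simps)
    then have "sqrt (c * (norm x)\<^sup>2) \<le> sqrt ((norm (S x))\<^sup>2)" by (rule real_sqrt_le_mono)
    then show ?thesis by (simp add: real_sqrt_mult)
  qed
  then show ?thesis using c(1) by (intro exI[of _ "sqrt c"]) auto
qed

lemma left_invertible_S: "left_invertible_on K S"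
proof -
  obtain c where c: "c > 0" "\<And>x. x \<in> K \<Longrightarrow> c * norm x \<le> norm (S x)"
    using S_bounded_below by blast
  note lin = bounded_op_linear[OF bounded_op_S] and V = csubspace_imp_subspace[OF csubspace_K]
  have "inj_on S K"
  proof (rule inj_onI)
    fix x y assume xy: "x \<in> K" "y \<in> K" "S x = S y"
    have "c * norm (x - y) \<le> 0"
      using c(2)[OF subspace_diff[OF V xy(1,2)]] xy(3) by (simp add: linear_simps[OF lin])
    then show "x = y" using c(1) by (simp add: mult_le_0_iff)
  qed
  moreover have "complete (S ` K)"
    using c closed_K by (intro complete_isometric_image[OF c(1) V lin])
      (auto simp: complete_eq_closed mult.commute)
  ultimately show ?thesis by (simp add: left_invertible_on_def complete_imp_closed)
qed

text \<open>
  The second application of \<open>S\<close> turns \<open>D h\<close> in coordinate 1 into \<open>W (D h) = E h\<close> in coordinate 2, and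
  \<open>A_E\<close> restores the form of \<open>A\<close> that the first application has produced. The coordinates from 2 on
  are shifted isometrically.
\<close>

lemma inner_S_S: "inner (S (S x)) (S (S y)) = inner (S x) (S y)"
proof -
  have "tail_inner (S x) (S y) = inner (W (ell2_nth x 1)) (W (ell2_nth y 1)) + tail_inner x y"
    using inner_ell2_split[of "S x" "S y"] inner_S[of x y] A_D[of "ell2_nth x 0" "ell2_nth y 0"]
    by simp
  then show ?thesis
    using A_E[of "ell2_nth x 0" "ell2_nth y 0"] by (simp add: inner_S WD)
qed

lemma quasi_isometry_S: "quasi_isometry_on K S"
  unfolding quasi_isometry_on_def
proof
  fix x assume "x \<in> K"
  note adj = inner_adj_on[OF csubspace_K closed_K bounded_op_on_K]
  show "adj_on K S (adj_on K S (S (S x))) = adj_on K S (S x)"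
    by (rule adj_on_eqI[OF csubspace_K bounded_op_on_K])
      (simp_all add: adj_on_mem[OF csubspace_K closed_K bounded_op_on_K] S_K inner_S_S flip: adj)
qed

lemma hilbert_extension_K: "hilbert_extension K (ell2_unit 0)"
  using csubspace_K closed_K csubspace_defect
  by (auto simp: hilbert_extension_def K_def ell2_unit_linear cinner_ell2_unit csubspace_def)

lemma lifting_S: "lifting K (ell2_unit 0) S T"
proof -
  have "proj_onto (ell2_unit 0) x = ell2_nth x 0" for x :: "'h ell2"
    by (rule proj_onto_eqI[OF hilbert_extension_K]) (simp add: inner_ell2_unit)
  then show ?thesis using hilbert_extension_K bounded_op_on_K by (simp add: lifting_def)
qed

lemma adj_S_S: "adj_on K S (S (ell2_unit 0 h)) = ell2_unit 0 (A h)"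
proof (rule adj_on_eqI[OF csubspace_K bounded_op_on_K])
  show "ell2_unit 0 (A h) \<in> K"
    using hilbert_extension_K by (auto simp: hilbert_extension_def)
  fix x
  have "inner (A (ell2_nth x 0)) h = inner (A h) (ell2_nth x 0)"
    by (metis A_D inner_commute)
  then show "inner (S x) (S (ell2_unit 0 h)) = inner x (ell2_unit 0 (A h))"
    using linear_simps(3)[OF bounded_op_linear[OF W]]
    by (simp add: inner_S tail_inner_def inner_commute[of x] inner_ell2_unit)
qed

text \<open>
  From \<open>\<H>\<close> the vectors \<open>D h\<close> in coordinate 1 are reached as \<open>S h - T h\<close>, hence by closure the
  whole defect space there. As \<open>W\<close> is onto the defect space, \<open>S\<close> carries it to every later coordinate,
  and sequences are limits of their finite sections.
\<close>

lemma minimal_S: "K = closure (cspan (\<Union>n. (S ^^ n) ` range (ell2_unit 0)))"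
proof
  define G where "G = (\<Union>n. (S ^^ n) ` range (ell2_unit 0))"
  define L where "L = closure (cspan G)"
  have span: "csubspace (cspan G)"
    unfolding cspan_def by (rule hull_in) (auto simp: csubspace_def)
  have "G \<subseteq> cspan G" unfolding cspan_def by (rule hull_subset)
  then have GL: "G \<subseteq> L" using closure_subset by (auto simp: L_def)
  have L: "csubspace L" "closed L" using csubspace_closure[OF span] by (auto simp: L_def)
  have least: "L \<subseteq> X" if "G \<subseteq> X" "csubspace X" "closed X" for X
    unfolding L_def cspan_def using that by (intro closure_minimal hull_minimal)
  have "(S ^^ n) (ell2_unit 0 h) \<in> K" for n h
    by (induction n) (use hilbert_extension_K in \<open>auto simp: S_K hilbert_extension_def\<close>)
  then have "G \<subseteq> K" by (auto simp: G_def)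
  then show "closure (cspan G) \<subseteq> K"
    using least csubspace_K closed_K by (auto simp: L_def)

  have "L \<subseteq> {x. S x \<in> L}"
  proof (rule least)
    have "S x \<in> G" if "x \<in> G" for x
    proof -
      obtain n h where "x = (S ^^ n) (ell2_unit 0 h)" using \<open>x \<in> G\<close> by (auto simp: G_def)
      then have "S x = (S ^^ Suc n) (ell2_unit 0 h)" by simp
      then show ?thesis unfolding G_def by blast
    qed
    then show "G \<subseteq> {x. S x \<in> L}" using GL by auto
    show "csubspace {x. S x \<in> L}"
      using L(1) linear_simps(3)[OF bounded_op_linear[OF bounded_op_S]]
      by (auto simp: csubspace_def S_linear)
    show "closed {x. S x \<in> L}"
      using continuous_closed_vimage[OF L(2)
          linear_continuous_at[OF bounded_op_linear[OF bounded_op_S]]] by (simp add: vimage_def)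
  qed
  then have SL: "S x \<in> L" if "x \<in> L" for x using that by auto
  have L0: "ell2_unit 0 h \<in> L" for h
  proof -
    have "(S ^^ 0) (ell2_unit 0 h) \<in> G" unfolding G_def by blast
    then show ?thesis using GL by auto
  qed
  have L1: "ell2_unit 1 d \<in> L" if "d \<in> defect" for d
  proof -
    have "ell2_unit 1 (D h) \<in> L" for h
    proof -
      have "ell2_unit 1 (D h) = S (ell2_unit 0 h) - ell2_unit 0 (T h)"
        by (rule ell2_eqI) (auto simp: lifting_seq_def linear_simps(3)[OF bounded_op_linear[OF W]] split: nat.split)
      then show ?thesis
        using subspace_diff[OF csubspace_imp_subspace[OF L(1)] SL[OF L0] L0] by simp
    qed
    then have "range D \<subseteq> {d. ell2_unit 1 d \<in> L}" by auto
    moreover have "closed {d. ell2_unit 1 d \<in> L}"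
      using continuous_closed_vimage[OF L(2) linear_continuous_at[OF bounded_linear_ell2_unit]]
      by (simp add: vimage_def)
    ultimately have "defect \<subseteq> {d. ell2_unit 1 d \<in> L}"
      unfolding defect_def by (rule closure_minimal)
    then show ?thesis using that by auto
  qed
  have S_unit: "S (ell2_unit (Suc 0) d) = ell2_unit (Suc (Suc 0)) (W d)"
    "S (ell2_unit (Suc (Suc n)) d) = ell2_unit (Suc (Suc (Suc n))) d" for n d
    by (auto intro!: ell2_eqI simp: lifting_seq_def linear_simps(3)[OF bounded_op_linear]
        T D W split: nat.split)
  have L_unit: "ell2_unit (Suc n) d \<in> L" if "d \<in> defect" for n d
    using that
  proof (induction n arbitrary: d)
    case 0
    then show ?case using L1 by simp
  next
    case (Suc n)
    show ?case
    proof (cases n)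
      case 0
      have "S (ell2_unit (Suc 0) (W' d)) \<in> L" using SL L1 W'_defect[OF Suc.prems] by simp
      then show ?thesis by (simp add: S_unit W_inverse Suc.prems 0)
    next
      case (Suc m)
      then show ?thesis using SL[OF Suc.IH[OF Suc.prems]] by (simp add: S_unit)
    qed
  qed
  show "K \<subseteq> closure (cspan G)"
  proof
    fix x assume "x \<in> K"
    have "ell2_unit k (ell2_nth x k) \<in> L" for k
      using L0 L_unit \<open>x \<in> K\<close> by (cases k) (auto simp: K_def)
    then have "(\<Sum>k<N. ell2_unit k (ell2_nth x k)) \<in> L" for N
      by (intro subspace_sum csubspace_imp_subspace L)
    then show "x \<in> closure (cspan G)"
      using closed_sequentially[OF L(2) _ ell2_unit_expansion] by (simp add: L_def)
  qed
qed

end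

lemma minimal_lifting_if_lifting_weight:
  fixes T :: "'h::chilbert_space \<Rightarrow> 'h"
  assumes T: "bounded_op T" and weight: "lifting_weight T A"
  shows "\<exists>(K :: 'h ell2 set) J S.
    minimal_lifting K J S T \<and> left_invertible_on K S \<and> quasi_isometry_on K S \<and>
    (adj_on K S \<circ> S) ` range J \<subseteq> range J"
proof -
  let ?D = "\<lambda>h. A h - (adj T \<circ> T) h" and ?E = "\<lambda>h. A h - (adj T \<circ> A \<circ> T) h"
  have inv: "invertible_op A" and D: "positive_op ?D" and E: "positive_op ?E"
    and range_eq: "range (op_sqrt ?D) = range (op_sqrt ?E)"
    using weight by (auto simp: lifting_weight_def op_ge_def)
  have A: "bounded_op A" using inv by (simp add: invertible_op_def)
  note bounded = bounded_op_defects[OF T A] and form = inner_defects[OF T]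
  define R where "R = op_sqrt ?D"
  define Q where "Q = op_sqrt ?E"
  have sqrt_form: "inner (op_sqrt B x) (op_sqrt B y) = inner (B x) y"
    if "bounded_op B" "positive_op B" for B :: "'h \<Rightarrow> 'h" and x y
    using positive_op_sqrt[OF that] op_sqrt_sqrt[OF that]
    by (metis bounded_op_sqrt[OF that] positive_op_iff)
  have A_R: "inner (T h) (T g) + inner (R h) (R g) = inner (A h) g" for h g
    unfolding R_def sqrt_form[OF bounded(1) D] form by simp
  have A_Q: "inner (A (T h)) (T g) + inner (Q h) (Q g) = inner (A h) g" for h g
    unfolding Q_def sqrt_form[OF bounded(2) E] form by simp
  have sym: "inner (A x) y = inner x (A y)" for x y
    by (metis A_R inner_commute)
  have pos: "0 \<le> inner (A x) x" for x
    by (simp flip: A_R)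
  obtain a where a: "a > 0" "\<And>h. a * (norm h)\<^sup>2 \<le> inner (A h) h"
    using coercive_if_invertible_op[OF inv sym pos] by blast
  have R: "bounded_op R" and Q: "bounded_op Q"
    unfolding R_def Q_def by (rule bounded_op_sqrt[OF bounded(1) D] bounded_op_sqrt[OF bounded(2) E])+
  obtain c where c: "c > 0" "\<And>x. norm (Q x) \<le> c * norm (R x)"
    using range_op_sqrt_subset_iff[OF bounded(2) E bounded(1) D] range_eq
    unfolding R_def Q_def by blast
  obtain W where W: "bounded_op W" "\<And>x. W (R x) = Q x"
    using bounded_op_factor[OF Q R c(2)] c(1) by auto
  obtain c' where c': "c' > 0" "\<And>x. norm (R x) \<le> c' * norm (Q x)"
    using range_op_sqrt_subset_iff[OF bounded(1) D bounded(2) E] range_eq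
    unfolding R_def Q_def by blast
  obtain W' where W': "bounded_op W'" "\<And>x. W' (Q x) = R x"
    using bounded_op_factor[OF R Q c'(2)] c'(1) by auto
  interpret lifting_model T A R Q W W' a
    by unfold_locales (simp_all add: T A R Q W W' a A_R A_Q, simp only: R_def Q_def range_eq)
  have "minimal_lifting K (ell2_unit 0) S T"
    using lifting_S minimal_S by (simp add: minimal_lifting_def)
  moreover have "(adj_on K S \<circ> S) ` range (ell2_unit 0) \<subseteq> range (ell2_unit 0)"
    by (auto simp: adj_S_S)
  ultimately show ?thesis using left_invertible_S quasi_isometry_S by blast
qed

theorem theorem2p1:
  fixes T :: "'h::chilbert_space \<Rightarrow> 'h"
  assumes "bounded_op T"
  shows
    "((\<exists>(K :: 'h ell2 set) J S.
          lifting K J S T \<and> left_invertible_on K S \<and> quasi_isometry_on K S \<and>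
          (adj_on K S \<circ> S) ` range J \<subseteq> range J)
      \<longleftrightarrow>
      (\<exists>A. invertible_op A \<and> A \<ge>\<^sub>o\<^sub>p adj T \<circ> T \<and> A \<ge>\<^sub>o\<^sub>p adj T \<circ> A \<circ> T \<and>
          range (op_sqrt (\<lambda>h. A h - (adj T \<circ> T) h)) =
          range (op_sqrt (\<lambda>h. A h - (adj T \<circ> A \<circ> T) h))))
     \<and>
     ((\<exists>(K :: 'k::chilbert_space set) J S.
          lifting K J S T \<and> left_invertible_on K S \<and> quasi_isometry_on K S \<and>
          (adj_on K S \<circ> S) ` range J \<subseteq> range J)
      \<longrightarrow>
      (\<exists>A. invertible_op A \<and> A \<ge>\<^sub>o\<^sub>p adj T \<circ> T \<and> A \<ge>\<^sub>o\<^sub>p adj T \<circ> A \<circ> T \<and>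
          range (op_sqrt (\<lambda>h. A h - (adj T \<circ> T) h)) =
          range (op_sqrt (\<lambda>h. A h - (adj T \<circ> A \<circ> T) h))))
     \<and>
     ((\<exists>A. invertible_op A \<and> A \<ge>\<^sub>o\<^sub>p adj T \<circ> T \<and> A \<ge>\<^sub>o\<^sub>p adj T \<circ> A \<circ> T \<and>
          range (op_sqrt (\<lambda>h. A h - (adj T \<circ> T) h)) =
          range (op_sqrt (\<lambda>h. A h - (adj T \<circ> A \<circ> T) h)))
      \<longrightarrow>
      (\<exists>(K :: 'h ell2 set) J S.
          minimal_lifting K J S T \<and> left_invertible_on K S \<and> quasi_isometry_on K S \<and>
          (adj_on K S \<circ> S) ` range J \<subseteq> range J))"
  unfolding lifting_weight_def[symmetric]
proof (intro conjI iffI impI)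
  assume "\<exists>(K :: 'h ell2 set) J S. lifting K J S T \<and> left_invertible_on K S \<and>
    quasi_isometry_on K S \<and> (adj_on K S \<circ> S) ` range J \<subseteq> range J"
  then show "\<exists>A. lifting_weight T A" by (elim exE conjE) (rule lifting_weight_if_lifting[OF assms])
next
  assume "\<exists>(K :: 'k set) J S. lifting K J S T \<and> left_invertible_on K S \<and>
    quasi_isometry_on K S \<and> (adj_on K S \<circ> S) ` range J \<subseteq> range J"
  then show "\<exists>A. lifting_weight T A" by (elim exE conjE) (rule lifting_weight_if_lifting[OF assms])
next
  assume "\<exists>A. lifting_weight T A"
  then show minimal: "\<exists>(K :: 'h ell2 set) J S. minimal_lifting K J S T \<and>
      left_invertible_on K S \<and> quasi_isometry_on K S \<and> (adj_on K S \<circ> S) ` range J \<subseteq> range J"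
    by (elim exE) (rule minimal_lifting_if_lifting_weight[OF assms])
  then show "\<exists>(K :: 'h ell2 set) J S. lifting K J S T \<and>
      left_invertible_on K S \<and> quasi_isometry_on K S \<and> (adj_on K S \<circ> S) ` range J \<subseteq> range J"
    unfolding minimal_lifting_def by (elim exE conjE) (intro exI conjI)
qed

end
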